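(* Let $g\ge3$, $k\ge0$, and let $m,n\ge 1$ be odd integers. Then for non-negative integers $\alpha,\beta$, $\mathrm{HWP}(C_g[2^{k+2}mn];\, gm,\, 2^kgn;\,\alpha,\beta)$ has a solution if and only if $\alpha+\beta=2^{k+2}mn$.
   Context: $C_g[u]$ is the graph with vertices $x_{i,j}$, $i\in\mathbb{Z}_g$, $0\le j\le u-1$, and edges $x_{i,a}x_{i+1,b}$ for all $i\in\mathbb{Z}_g$ and $0\le a,b\le u-1$. A $C_\ell$-factor of a graph is a spanning subgraph all of whose components are cycles of length $\ell$. For integers $M,N\ge3$ and non-negative integers $\alpha,\beta$, a solution to $\mathrm{HWP}(G;M,N;\alpha,\beta)$ is a partition of the edge set of the graph $G$ into $\alpha$ $C_M$-factors and $\beta$ $C_N$-factors. *)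

theory Defs
  imports Main
begin

text \<open>A (simple) graph is a pair (V, E) of a vertex set and a set of edges,
each edge being a 2-element subset of V.\<close>

type_synonym 'v graph = "'v set \<times> 'v set set"

definition Cg_blowup :: "nat \<Rightarrow> nat \<Rightarrow> (nat \<times> nat) graph" where
  "Cg_blowup g u =
     ({(i, j). i < g \<and> j < u},
      {{(i, a), ((i + 1) mod g, b)} | i a b. i < g \<and> a < u \<and> b < u})"

definition cycle_edges :: "'v list \<Rightarrow> 'v set set" where
  "cycle_edges vs = {{vs ! i, vs ! (Suc i mod length vs)} | i. i < length vs}"

definition is_cycle :: "nat \<Rightarrow> 'v set \<Rightarrow> 'v set set \<Rightarrow> bool" where
  "is_cycle l S C \<longleftrightarrow> l \<ge> 3 \<and>
     (\<exists>vs. distinct vs \<and> length vs = l \<and> set vs = S \<and> C = cycle_edges vs)"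

definition is_cycle_factor :: "'v graph \<Rightarrow> nat \<Rightarrow> 'v set set \<Rightarrow> bool" where
  "is_cycle_factor G l F \<longleftrightarrow> F \<subseteq> snd G \<and>
     (\<exists>P :: ('v set \<times> 'v set set) set.
        (\<forall>(S, C) \<in> P. is_cycle l S C) \<and>
        (\<forall>(S, C) \<in> P. \<forall>(S', C') \<in> P. (S, C) \<noteq> (S', C') \<longrightarrow> S \<inter> S' = {}) \<and>
        \<Union> (fst ` P) = fst G \<and>
        \<Union> (snd ` P) = F)"

definition HWP :: "'v graph \<Rightarrow> nat \<Rightarrow> nat \<Rightarrow> nat \<Rightarrow> nat \<Rightarrow> bool" where
  "HWP G M N \<alpha> \<beta> \<longleftrightarrow>
     (\<exists>A B :: nat \<Rightarrow> 'v set set.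
        (\<forall>i < \<alpha>. is_cycle_factor G M (A i)) \<and>
        (\<forall>j < \<beta>. is_cycle_factor G N (B j)) \<and>
        (\<forall>i < \<alpha>. \<forall>i' < \<alpha>. i \<noteq> i' \<longrightarrow> A i \<inter> A i' = {}) \<and>
        (\<forall>j < \<beta>. \<forall>j' < \<beta>. j \<noteq> j' \<longrightarrow> B j \<inter> B j' = {}) \<and>
        (\<forall>i < \<alpha>. \<forall>j < \<beta>. A i \<inter> B j = {}) \<and>
        (\<Union>i<\<alpha>. A i) \<union> (\<Union>j<\<beta>. B j) = snd G)"

end

theory Submission
  imports Defs "HOL-Algebra.Elementary_Groups" "HOL-Computational_Algebra.Primes"
begin

text \<open>
  Necessity is a count of edges: a cycle factor has as many edges as vertices.

  For sufficiency, identify the vertices of every layer with a group \<open>G\<close> of order \<open>u\<close>. Given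
  bijections \<open>s\<^sub>0, \<dots>, s\<^sub>g\<^sub>-\<^sub>1\<close> from an index set onto \<open>G\<close>, the edges from \<open>(i, x)\<close> to
  \<open>(i + 1, x s\<^sub>i(t))\<close> form for every \<open>t\<close> a 2-factor whose cycles have length \<open>g\<close> times the order of
  \<open>d(t) = s\<^sub>0(t) \<cdots> s\<^sub>g\<^sub>-\<^sub>1(t)\<close>, and these 2-factors partition the edges. In an abelian group the
  product of all \<open>d(t)\<close> is prescribed, which excludes for instance \<open>\<alpha> = 1\<close>. In the dihedral group of
  order \<open>4M\<close> with rotation \<open>r\<close> there is no such obstruction to \<open>d(t) \<in> {1, r\<^sup>2}\<close>: from a complete
  mapping one gets three layers with \<open>d = 1\<close>, and local exchanges then produce any prescribed number
  of values \<open>r\<^sup>2\<close>. Complete mappings also allow to split a layer into two, hence to pass from \<open>3\<close> to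
  \<open>g\<close> layers.

  With \<open>M = lcm m (2\<^sup>k n)\<close> and \<open>q = gcd m (2\<^sup>k n)\<close> one takes the direct product of the dihedral group
  of order \<open>4M\<close> and the cyclic group of order \<open>q\<close>, where \<open>d\<close> has a constant generator as its second
  component and values \<open>r\<^sup>2\<^sup>x\<close>, \<open>r\<^sup>2\<^sup>x\<^sup>-\<^sup>2\<close> as its first, for a suitable \<open>x\<close>.
\<close>

section \<open>Cycle factors of the blown-up cycle\<close>

lemma card_cycle_edges:
  assumes "distinct vs" "length vs \<ge> 3"
  shows "card (cycle_edges vs) = length vs"
proof -
  let ?l = "length vs"
  let ?e = "\<lambda>i. {vs ! i, vs ! (Suc i mod ?l)}"
  have "inj_on ?e {..<?l}"
  proof (rule inj_onI)
    fix i j assume ij: "i \<in> {..<?l}" "j \<in> {..<?l}" and eq: "?e i = ?e j"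
    have lt: "Suc i mod ?l < ?l" "Suc j mod ?l < ?l"
      using assms by (auto intro!: mod_less_divisor)
    have nth_eq: "vs ! a = vs ! b \<longleftrightarrow> a = b" if "a < ?l" "b < ?l" for a b
      using that assms(1) by (simp add: nth_eq_iff_index_eq)
    have "i = j \<or> i = Suc j mod ?l \<and> Suc i mod ?l = j"
      using eq ij lt nth_eq by (auto simp: doubleton_eq_iff)
    \<comment> \<open>If each of two indices were the cyclic successor of the other, the length
      would divide 2.\<close>
    moreover have "\<not> (i = Suc j mod ?l \<and> Suc i mod ?l = j)"
      using ij assms(2) by (auto simp: mod_Suc split: if_splits)
    ultimately show "i = j" by blast
  qed
  moreover have "cycle_edges vs = ?e ` {..<?l}"
    by (auto simp: cycle_edges_def)
  ultimately show ?thesis by (simp add: card_image)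
qed

lemma cycle_edges_subset:
  assumes "C \<in> cycle_edges vs"
  shows "C \<subseteq> set vs" "C \<noteq> {}"
proof -
  obtain i where i: "i < length vs" "C = {vs ! i, vs ! (Suc i mod length vs)}"
    using assms by (auto simp: cycle_edges_def)
  have "Suc i mod length vs < length vs"
    using i(1) by (intro mod_less_divisor) auto
  then show "C \<subseteq> set vs" "C \<noteq> {}" using i by auto
qed

text \<open>Edges are nonempty subsets of the vertex set of their cycle, so disjoint vertex sets
  force disjoint edge sets. The equal edge and vertex counts of the single cycles can then be
  summed.\<close>

lemma card_cycle_factor:
  assumes F: "is_cycle_factor G l F" and fin: "finite (fst G)" "finite (snd G)"
  shows "card F = card (fst G)"
proof -
  obtain P where cyc: "\<forall>(S, C) \<in> P. is_cycle l S C"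
    and disj: "\<forall>(S, C) \<in> P. \<forall>(S', C') \<in> P. (S, C) \<noteq> (S', C') \<longrightarrow> S \<inter> S' = {}"
    and V: "\<Union> (fst ` P) = fst G" and E: "\<Union> (snd ` P) = F" and "F \<subseteq> snd G"
    using F unfolding is_cycle_factor_def by blast
  have "P \<subseteq> Pow (fst G) \<times> Pow (snd G)"
    using V E \<open>F \<subseteq> snd G\<close> by fastforce
  then have finP: "finite P"
    using fin by (meson finite_Pow_iff finite_SigmaI finite_subset)
  have fins: "finite (fst x)" "finite (snd x)" if "x \<in> P" for x
    using subsetD[OF \<open>P \<subseteq> _\<close> that] fin by (auto simp: mem_Times_iff intro: finite_subset)
  have card_eq: "card (snd x) = card (fst x)" if "x \<in> P" for x
  proof -
    have "is_cycle l (fst x) (snd x)" using cyc that by (auto simp: case_prod_beta)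
    then show ?thesis by (auto simp: is_cycle_def card_cycle_edges distinct_card dest: sym)
  qed
  have sub: "e \<subseteq> fst x \<and> e \<noteq> {}" if "x \<in> P" "e \<in> snd x" for x e
  proof -
    have "is_cycle l (fst x) (snd x)" using cyc that(1) by (auto simp: case_prod_beta)
    then obtain vs where "set vs = fst x" "snd x = cycle_edges vs"
      by (auto simp: is_cycle_def)
    then show ?thesis using that(2) cycle_edges_subset[of e vs] by auto
  qed
  have dV: "fst x \<inter> fst y = {}" if "x \<in> P" "y \<in> P" "x \<noteq> y" for x y
    using disj that by (metis (mono_tags, lifting) case_prodD prod.collapse)
  have dE: "snd x \<inter> snd y = {}" if "x \<in> P" "y \<in> P" "x \<noteq> y" for x y
    using dV[OF that] sub that by blast
  have "card F = (\<Sum>x\<in>P. card (snd x))"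
    unfolding E[symmetric] using finP fins dE by (intro card_UN_disjoint) auto
  also have "\<dots> = (\<Sum>x\<in>P. card (fst x))"
    by (intro sum.cong) (auto simp: card_eq)
  also have "\<dots> = card (fst G)"
    unfolding V[symmetric] using finP fins dV by (intro card_UN_disjoint[symmetric]) auto
  finally show ?thesis .
qed

definition blowup_edge :: "nat \<Rightarrow> nat \<Rightarrow> nat \<Rightarrow> nat \<Rightarrow> (nat \<times> nat) set" where
  "blowup_edge g i a b = {(i, a), ((i + 1) mod g, b)}"

text \<open>For \<open>g \<ge> 3\<close> no two layers are successors of each other, so an edge
  determines its orientation and the layer it leaves.\<close>

lemma blowup_edge_eq_iff:
  assumes "g \<ge> 3" "i < g" "j < g"
  shows "blowup_edge g i a b = blowup_edge g j c d \<longleftrightarrow> i = j \<and> a = c \<and> b = d"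
proof -
  have "(i + 1) mod g \<noteq> i" "\<not> (i = (j + 1) mod g \<and> (i + 1) mod g = j)"
    using assms by (auto simp: mod_Suc split: if_splits)
  then show ?thesis by (auto simp: blowup_edge_def doubleton_eq_iff)
qed

lemma snd_Cg_blowup:
  "snd (Cg_blowup g u) = (\<lambda>(i, a, b). blowup_edge g i a b) ` ({..<g} \<times> {..<u} \<times> {..<u})"
  by (auto simp: Cg_blowup_def blowup_edge_def image_def)

lemma fst_Cg_blowup: "fst (Cg_blowup g u) = {..<g} \<times> {..<u}"
  by (auto simp: Cg_blowup_def)

lemma card_edges_Cg_blowup:
  assumes "g \<ge> 3"
  shows "card (snd (Cg_blowup g u)) = g * u * u"
proof -
  have "inj_on (\<lambda>(i, a, b). blowup_edge g i a b) ({..<g} \<times> {..<u} \<times> {..<u})"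
    using assms by (auto simp: inj_on_def blowup_edge_eq_iff)
  then show ?thesis by (simp add: snd_Cg_blowup card_image card_cartesian_product)
qed

text \<open>The graph has \<open>g * u * u\<close> edges, and each factor has \<open>g * u\<close>
  of them whatever its cycle length.\<close>

lemma HWP_Cg_blowup_imp_sum:
  assumes "g \<ge> 3" "u > 0" "HWP (Cg_blowup g u) M N \<alpha> \<beta>"
  shows "\<alpha> + \<beta> = u"
proof -
  let ?G = "Cg_blowup g u"
  obtain A B where A: "\<And>i. i < \<alpha> \<Longrightarrow> is_cycle_factor ?G M (A i)"
    and B: "\<And>j. j < \<beta> \<Longrightarrow> is_cycle_factor ?G N (B j)"
    and AA: "\<And>i i'. i < \<alpha> \<Longrightarrow> i' < \<alpha> \<Longrightarrow> i \<noteq> i' \<Longrightarrow> A i \<inter> A i' = {}"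
    and BB: "\<And>i i'. i < \<beta> \<Longrightarrow> i' < \<beta> \<Longrightarrow> i \<noteq> i' \<Longrightarrow> B i \<inter> B i' = {}"
    and AB: "\<And>i j. i < \<alpha> \<Longrightarrow> j < \<beta> \<Longrightarrow> A i \<inter> B j = {}"
    and U: "(\<Union>i<\<alpha>. A i) \<union> (\<Union>j<\<beta>. B j) = snd ?G"
    using assms(3) unfolding HWP_def by (elim exE conjE) (rule that; simp)
  have fin: "finite (fst ?G)" "finite (snd ?G)"
    by (auto simp: fst_Cg_blowup snd_Cg_blowup)
  have cV: "card (fst ?G) = g * u" by (simp add: fst_Cg_blowup card_cartesian_product)
  have finA: "finite (A i)" if "i < \<alpha>" for i using that by (intro finite_subset[OF _ fin(2)]) (auto simp flip: U)
  have finB: "finite (B i)" if "i < \<beta>" for i using that by (intro finite_subset[OF _ fin(2)]) (auto simp flip: U)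
  have "card (\<Union>i<\<alpha>. A i) = (\<Sum>i<\<alpha>. card (A i))"
    by (rule card_UN_disjoint) (auto simp: finA AA)
  moreover have "card (\<Union>i<\<beta>. B i) = (\<Sum>i<\<beta>. card (B i))"
    by (rule card_UN_disjoint) (auto simp: finB BB)
  moreover have "card (snd ?G) = card (\<Union>i<\<alpha>. A i) + card (\<Union>j<\<beta>. B j)"
    unfolding U[symmetric] by (rule card_Un_disjoint) (use finA finB AB in blast)+
  ultimately have "g * u * u = (\<alpha> + \<beta>) * (g * u)"
    using card_cycle_factor[OF A fin] card_cycle_factor[OF B fin] card_edges_Cg_blowup[OF assms(1), of u]
    by (simp add: cV algebra_simps)
  then show ?thesis using assms(1,2) by (simp add: mult.commute)
qed

section \<open>Cycle factors from permutations between consecutive layers\<close>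

primrec layer_comp :: "(nat \<Rightarrow> 'a \<Rightarrow> 'a) \<Rightarrow> nat \<Rightarrow> 'a \<Rightarrow> 'a" where
  "layer_comp \<sigma> 0 a = a"
| "layer_comp \<sigma> (Suc i) a = \<sigma> i (layer_comp \<sigma> i a)"

lemma bij_betw_layer_comp:
  assumes "\<And>i. i < g \<Longrightarrow> bij_betw (\<sigma> i) X X" "i \<le> g"
  shows "bij_betw (layer_comp \<sigma> i) X X"
  using assms(2)
proof (induction i)
  case 0
  then show ?case by (auto simp: bij_betw_def inj_on_def)
next
  case (Suc i)
  have "bij_betw (\<sigma> i \<circ> layer_comp \<sigma> i) X X"
    using Suc assms(1) by (intro bij_betw_trans) auto
  then show ?case by (simp add: o_def cong: bij_betw_cong)
qed

definition layer_factor :: "nat \<Rightarrow> nat \<Rightarrow> (nat \<Rightarrow> nat \<Rightarrow> nat) \<Rightarrow> (nat \<times> nat) set set" where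
  "layer_factor g u \<sigma> = (\<lambda>(i, a). blowup_edge g i a (\<sigma> i a)) ` ({..<g} \<times> {..<u})"

text \<open>Following the permutations from \<open>x\<close> in layer 0 leads back to layer 0 after
  \<open>g\<close> steps, at \<open>D x\<close>. All orbits of \<open>D\<close> have length exactly
  \<open>l\<close>, so every such walk closes up after \<open>g * l\<close> steps and not
  before.\<close>

lemma is_cycle_factor_layer_factor:
  assumes g: "g \<ge> 3" and l: "l \<ge> 1"
    and bij: "\<And>i. i < g \<Longrightarrow> bij_betw (\<sigma> i) {..<u} {..<u}"
    and D: "D = layer_comp \<sigma> g"
    and per: "\<And>a. a < u \<Longrightarrow> (D ^^ l) a = a"
    and min: "\<And>a r. a < u \<Longrightarrow> 0 < r \<Longrightarrow> r < l \<Longrightarrow> (D ^^ r) a \<noteq> a"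
  shows "is_cycle_factor (Cg_blowup g u) (g * l) (layer_factor g u \<sigma>)"
proof -
  define step where "step = (\<lambda>(i, a). ((i + 1) mod g, \<sigma> i a))"
  define walk where "walk x k = (step ^^ k) (0::nat, x::nat)" for x k
  define L where "L = g * l"
  define vs where "vs x = map (walk x) [0..<L]" for x
  define E where "E = (\<lambda>(i, a). blowup_edge g i a (\<sigma> i a))"
  have L: "L \<ge> g" "L > 0" using g l by (auto simp: L_def)
  have bijc: "bij_betw (layer_comp \<sigma> i) {..<u} {..<u}" if "i \<le> g" for i
    using bij_betw_layer_comp[of g \<sigma> "{..<u}" i] bij that by blast
  have Dlt: "(D ^^ r) x < u" if "x < u" for x r
  proof (induction r)
    case (Suc r)
    then show ?case using bijc[of g] D by (auto simp: bij_betw_def)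
  qed (use that in simp)
  have walk_i: "(step ^^ i) (0, x) = (i, layer_comp \<sigma> i x)" if "i < g" for i x
    using that by (induction i) (auto simp: step_def)
  have walk_g: "(step ^^ g) (0, x) = (0, D x)" for x
  proof -
    obtain g' where g': "g = Suc g'" using g by (cases g) auto
    show ?thesis using walk_i[of g' x] D g' by (auto simp: step_def)
  qed
  have walk_gr: "(step ^^ (g * r)) (0, x) = (0, (D ^^ r) x)" for r x
  proof (induction r)
    case (Suc r)
    have "(step ^^ (g * Suc r)) (0, x) = (step ^^ g) ((step ^^ (g * r)) (0, x))"
      by (simp add: funpow_add)
    then show ?case using Suc walk_g by simp
  qed simp
  have walk_eq: "walk x k = (k mod g, layer_comp \<sigma> (k mod g) ((D ^^ (k div g)) x))" for x k
  proof -
    have "walk x k = (step ^^ (k mod g + g * (k div g))) (0, x)"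
      by (simp add: walk_def)
    also have "\<dots> = (step ^^ (k mod g)) (0, (D ^^ (k div g)) x)"
      by (simp only: funpow_add o_apply walk_gr)
    finally show ?thesis using walk_i[of "k mod g"] g by simp
  qed
  have walk_Suc: "walk x (Suc k) = step (walk x k)" for x k by (simp add: walk_def)
  have walk_add: "walk x (j + k) = (step ^^ j) (walk x k)" for x j k
    by (simp add: walk_def funpow_add)
  have walk_L: "walk x (L * r + k) = walk x k" if "x < u" for x k r
  proof (induction r)
    case (Suc r)
    have "walk x L = walk x 0" using walk_gr per that by (simp add: walk_def L_def)
    then have "walk x ((L * r + k) + L) = walk x ((L * r + k) + 0)" using walk_add by metis
    then show ?case using Suc by (simp add: ac_simps)
  qed simp
  have walk_mod: "walk x (k mod L) = walk x k" if "x < u" for x k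
    using walk_L[OF that, of "k div L" "k mod L"] by simp
  have walk_in: "walk x k \<in> {..<g} \<times> {..<u}" if "x < u" for x k
    using bijc[of "k mod g"] g Dlt[OF that] by (auto simp: walk_eq bij_betw_def)
  have walk_inj: "inj_on (walk x) {..<L}" if x: "x < u" for x
  proof (rule inj_onI)
    fix k k' assume kk: "k \<in> {..<L}" "k' \<in> {..<L}" and eq: "walk x k = walk x k'"
    have m: "k mod g = k' mod g" using eq by (simp add: walk_eq)
    have "inj_on (layer_comp \<sigma> (k mod g)) {..<u}"
      using bijc[of "k mod g"] g by (auto simp: bij_betw_def)
    then have De: "(D ^^ (k div g)) x = (D ^^ (k' div g)) x"
      using eq m Dlt[OF x] by (auto simp: walk_eq inj_on_def)
    have lt: "k div g < l" "k' div g < l"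
      using kk by (auto simp: L_def less_mult_imp_div_less mult.commute)
    have False if "r < s" "s < l" "(D ^^ r) x = (D ^^ s) x" for r s
    proof -
      \<comment> \<open>\<open>D ^^ (s - r)\<close> would fix \<open>(D ^^ r) x\<close>, which is
        again a point below \<open>u\<close>, against \<open>min\<close>.\<close>
      have "(D ^^ (s - r)) ((D ^^ r) x) = (D ^^ s) x"
        using that(1) by (metis add_diff_inverse_nat add.commute funpow_add less_imp_not_less o_apply)
      moreover have "s - r < l" "0 < s - r" using that by auto
      ultimately show False using min[of "(D ^^ r) x" "s - r"] that(3) Dlt[OF x] by simp
    qed
    then have "k div g = k' div g" using De lt by (metis linorder_neqE_nat)
    then show "k = k'" using m by (metis div_mult_mod_eq)
  qed
  have set_vs: "set (vs x) = range (walk x)" if "x < u" for x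
  proof -
    have "walk x k \<in> walk x ` {..<L}" for k
      using walk_mod[OF that, of k] L by (metis imageI lessThan_iff mod_less_divisor)
    then show ?thesis by (auto simp: vs_def lessThan_atLeast0)
  qed
  have edges: "cycle_edges (vs x) = E ` set (vs x)" if "x < u" for x
  proof -
    have "{vs x ! k, vs x ! (Suc k mod L)} = E (walk x k)" if "k < L" for k
    proof -
      have "vs x ! (Suc k mod L) = step (walk x k)"
        using L that walk_mod[OF \<open>x < u\<close>, of "Suc k"] by (simp add: vs_def walk_Suc)
      then show ?thesis using that
        by (auto simp: vs_def E_def step_def blowup_edge_def split: prod.splits)
    qed
    moreover have "length (vs x) = L" by (simp add: vs_def)
    ultimately have "cycle_edges (vs x) = (\<lambda>k. E (walk x k)) ` {..<L}"
      unfolding cycle_edges_def by (auto simp: image_def)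
    also have "\<dots> = E ` set (vs x)" by (auto simp: vs_def)
    finally show ?thesis .
  qed
  have mono: "set (vs x) \<subseteq> set (vs y)" if x: "x < u" and y: "y < u" and w: "walk x k = walk y k'" for x y k k'
  proof -
    have "walk x n \<in> range (walk y)" for n
    proof -
      \<comment> \<open>The index \<open>L * k + n\<close> is congruent to \<open>n\<close> modulo
        \<open>L\<close> and at least \<open>k\<close>, so it is reached by going forward from the
        common vertex.\<close>
      have ge: "L * k + n \<ge> k" using L by (simp add: trans_le_add1)
      have "walk x n = walk x (L * k + n)" using walk_L[OF x] by simp
      also have "\<dots> = (step ^^ (L * k + n - k)) (walk x k)"
        using walk_add[of x "L * k + n - k" k] ge by simp
      also have "\<dots> = walk y (L * k + n - k + k')"
        by (simp add: w walk_add)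
      finally show ?thesis by simp
    qed
    then show ?thesis using set_vs x y by auto
  qed
  \<comment> \<open>Starting points in the same orbit of \<open>D\<close> give the same cycle.
    Taking the edges as an image of the vertex set makes equal vertex sets give equal pairs, so such
    cycles are identified in \<open>P\<close>.\<close>
  define P where "P = (\<lambda>x. (set (vs x), E ` set (vs x))) ` {..<u}"
  have V: "(\<Union>x<u. set (vs x)) = {..<g} \<times> {..<u}"
  proof
    show "(\<Union>x<u. set (vs x)) \<subseteq> {..<g} \<times> {..<u}"
    proof
      fix w assume "w \<in> (\<Union>x<u. set (vs x))"
      then obtain x k where "x < u" "w = walk x k" by (auto simp: vs_def)
      then show "w \<in> {..<g} \<times> {..<u}" using walk_in by simp
    qed
    show "{..<g} \<times> {..<u} \<subseteq> (\<Union>x<u. set (vs x))"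
    proof
      fix w assume "w \<in> {..<g} \<times> {..<u}"
      then obtain i a where w: "w = (i, a)" "i < g" "a < u" by auto
      then obtain x where x: "x < u" "a = layer_comp \<sigma> i x"
        using bijc[of i] by (auto simp: bij_betw_def image_def)
      then have "w = walk x i" using w walk_i by (simp add: walk_def)
      then show "w \<in> (\<Union>x<u. set (vs x))" using x set_vs by auto
    qed
  qed
  have "is_cycle (g * l) (set (vs x)) (E ` set (vs x))" if "x < u" for x
    unfolding is_cycle_def
  proof (intro conjI exI[of _ "vs x"])
    show "g * l \<ge> 3" using L(1) g unfolding L_def by linarith
    show "distinct (vs x)" using walk_inj[OF that] by (simp add: vs_def distinct_map lessThan_atLeast0)
  qed (use edges that in \<open>auto simp: vs_def L_def\<close>)
  then have cyc: "\<forall>(S, C)\<in>P. is_cycle (g * l) S C" by (auto simp: P_def)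
  have eqS: "set (vs x) = set (vs y)" if xy: "x < u" "y < u" "set (vs x) \<inter> set (vs y) \<noteq> {}" for x y
  proof -
    obtain w where "w \<in> range (walk x)" "w \<in> range (walk y)"
      using xy(3) unfolding set_vs[OF xy(1)] set_vs[OF xy(2)] by blast
    then obtain k k' where w: "walk x k = walk y k'" by (metis rangeE)
    show ?thesis by (rule equalityI[OF mono[OF xy(1,2) w] mono[OF xy(2,1) w[symmetric]]])
  qed
  have disj: "\<forall>(S, C)\<in>P. \<forall>(S', C')\<in>P. (S, C) \<noteq> (S', C') \<longrightarrow> S \<inter> S' = {}"
  proof -
    have "S \<inter> S' = {}" if SC: "(S, C) \<in> P" "(S', C') \<in> P" and ne: "(S, C) \<noteq> (S', C')" for S C S' C'
    proof -
      obtain x y where "x < u" "y < u" "S = set (vs x)" "S' = set (vs y)"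
        "C = E ` S" "C' = E ` S'" using SC by (auto simp: P_def)
      then show ?thesis using eqS[of x y] ne by metis
    qed
    then show ?thesis by blast
  qed
  have F: "layer_factor g u \<sigma> = E ` ({..<g} \<times> {..<u})" by (simp add: layer_factor_def E_def)
  have "\<Union> (fst ` P) = fst (Cg_blowup g u)" using V by (simp add: P_def fst_Cg_blowup image_image)
  moreover have "\<Union> (snd ` P) = layer_factor g u \<sigma>"
    unfolding F V[symmetric] by (auto simp: P_def)
  moreover have "layer_factor g u \<sigma> \<subseteq> snd (Cg_blowup g u)"
  proof -
    have "\<sigma> i a < u" if "i < g" "a < u" for i a
      using bij[of i] that by (auto simp: bij_betw_def)
    then show ?thesis by (force simp: layer_factor_def snd_Cg_blowup)
  qed
  ultimately show ?thesis unfolding is_cycle_factor_def using cyc disj by blast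
qed

text \<open>The condition \<open>latin\<close> puts every edge leaving \<open>(i, a)\<close> into
  the factor of exactly one \<open>t\<close>, so the factors partition the edge set.\<close>

lemma HWP_of_latin_layers:
  fixes \<sigma> :: "'t \<Rightarrow> nat \<Rightarrow> nat \<Rightarrow> nat"
  assumes g: "g \<ge> 3" and S: "S \<subseteq> T" "finite T" "card S = \<alpha>" "card (T - S) = \<beta>"
    and latin: "\<And>i a. i < g \<Longrightarrow> a < u \<Longrightarrow> bij_betw (\<lambda>t. \<sigma> t i a) T {..<u}"
    and A: "\<And>t. t \<in> S \<Longrightarrow> is_cycle_factor (Cg_blowup g u) M (layer_factor g u (\<sigma> t))"
    and B: "\<And>t. t \<in> T - S \<Longrightarrow> is_cycle_factor (Cg_blowup g u) N (layer_factor g u (\<sigma> t))"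
  shows "HWP (Cg_blowup g u) M N \<alpha> \<beta>"
proof -
  let ?F = "\<lambda>t. layer_factor g u (\<sigma> t)"
  have disj: "?F t \<inter> ?F t' = {}" if t: "t \<in> T" "t' \<in> T" "t \<noteq> t'" for t t'
  proof -
    have "\<sigma> t i a \<noteq> \<sigma> t' i a" if "i < g" "a < u" for i a
      using latin[OF that] t by (auto simp: bij_betw_def inj_on_def)
    then show ?thesis using g by (auto simp: layer_factor_def blowup_edge_eq_iff)
  qed
  have cover: "(\<Union>t\<in>T. ?F t) = snd (Cg_blowup g u)"
  proof
    show "(\<Union>t\<in>T. ?F t) \<subseteq> snd (Cg_blowup g u)"
    proof -
      have "?F t \<subseteq> snd (Cg_blowup g u)" if "t \<in> T" for t
        using A[of t] B[of t] that by (cases "t \<in> S") (auto simp: is_cycle_factor_def)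
      then show ?thesis by blast
    qed
    show "snd (Cg_blowup g u) \<subseteq> (\<Union>t\<in>T. ?F t)"
    proof
      fix e assume "e \<in> snd (Cg_blowup g u)"
      then obtain i a b where e: "i < g" "a < u" "b < u" "e = blowup_edge g i a b"
        by (auto simp: snd_Cg_blowup)
      then obtain t where "t \<in> T" "b = \<sigma> t i a"
        using latin[of i a] by (auto simp: bij_betw_def image_def)
      then show "e \<in> (\<Union>t\<in>T. ?F t)" using e by (force simp: layer_factor_def)
    qed
  qed
  have "finite S" using S finite_subset by blast
  then obtain f where f: "bij_betw f {..<\<alpha>} S"
    using S(3) ex_bij_betw_nat_finite[of S] by (auto simp: lessThan_atLeast0)
  obtain h where h: "bij_betw h {..<\<beta>} (T - S)"
    using S ex_bij_betw_nat_finite[of "T - S"] by (auto simp: lessThan_atLeast0)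
  have fi: "f i \<in> S" if "i < \<alpha>" for i using f that by (auto simp: bij_betw_def)
  have hi: "h i \<in> T - S" if "i < \<beta>" for i using h that by (auto simp: bij_betw_def)
  show ?thesis unfolding HWP_def
  proof (rule exI[of _ "\<lambda>i. ?F (f i)"], rule exI[of _ "\<lambda>i. ?F (h i)"], intro conjI allI impI)
    fix i i' assume "i < \<alpha>" "i' < \<alpha>" "i \<noteq> i'"
    then show "?F (f i) \<inter> ?F (f i') = {}"
      using f fi S(1) by (intro disj) (auto simp: bij_betw_def inj_on_def)
  next
    fix i i' assume "i < \<beta>" "i' < \<beta>" "i \<noteq> i'"
    then show "?F (h i) \<inter> ?F (h i') = {}"
      using h hi by (intro disj) (auto simp: bij_betw_def inj_on_def)
  next
    fix i j assume "i < \<alpha>" "j < \<beta>"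
    then show "?F (f i) \<inter> ?F (h j) = {}"
      using fi[of i] hi[of j] S(1) by (intro disj) auto
  next
    have "(\<Union>i<\<alpha>. ?F (f i)) = (\<Union>t\<in>S. ?F t)" "(\<Union>j<\<beta>. ?F (h j)) = (\<Union>t\<in>T - S. ?F t)"
      using arg_cong[OF bij_betw_imp_surj_on[OF f], of "\<lambda>X. \<Union> (?F ` X)"]
        arg_cong[OF bij_betw_imp_surj_on[OF h], of "\<lambda>X. \<Union> (?F ` X)"]
      by (simp_all only: image_image)
    moreover have "(\<Union>t\<in>S. ?F t) \<union> (\<Union>t\<in>T - S. ?F t) = (\<Union>t\<in>T. ?F t)"
      using S(1) by blast
    ultimately show "(\<Union>i<\<alpha>. ?F (f i)) \<union> (\<Union>j<\<beta>. ?F (h j)) = snd (Cg_blowup g u)"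
      using cover by simp
  qed (use A B fi hi in auto)
qed

section \<open>Layers from a group\<close>

primrec layer_prod :: "('g, 'b) monoid_scheme \<Rightarrow> (nat \<Rightarrow> 't \<Rightarrow> 'g) \<Rightarrow> nat \<Rightarrow> 't \<Rightarrow> 'g" where
  "layer_prod G s 0 t = \<one>\<^bsub>G\<^esub>"
| "layer_prod G s (Suc i) t = layer_prod G s i t \<otimes>\<^bsub>G\<^esub> s i t"

definition factorable :: "('g, 'b) monoid_scheme \<Rightarrow> 't set \<Rightarrow> nat \<Rightarrow> ('t \<Rightarrow> 'g) \<Rightarrow> bool" where
  "factorable G T g d \<longleftrightarrow>
     (\<exists>s. (\<forall>i<g. bij_betw (s i) T (carrier G)) \<and> (\<forall>t\<in>T. layer_prod G s g t = d t))"

lemma layer_prod_cong: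
  "(\<And>i. i < g \<Longrightarrow> s i t = s' i t) \<Longrightarrow> layer_prod G s g t = layer_prod G s' g t"
  by (induction g) auto

lemma factorable_cong:
  "factorable G T g d \<Longrightarrow> (\<And>t. t \<in> T \<Longrightarrow> d t = d' t) \<Longrightarrow> factorable G T g d'"
  by (auto simp: factorable_def)

lemma factorable_finite:
  "factorable G T g d \<Longrightarrow> g > 0 \<Longrightarrow> finite (carrier G) \<Longrightarrow> finite T"
  using bij_betw_finite by (auto simp: factorable_def)

context group
begin

lemma layer_prod_closed:
  "(\<And>i. i < g \<Longrightarrow> s i t \<in> carrier G) \<Longrightarrow> layer_prod G s g t \<in> carrier G"
  by (induction g) auto

lemma factorable_3:
  assumes "bij_betw p T (carrier G)" "bij_betw q T (carrier G)" "bij_betw r T (carrier G)"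
    and "\<And>t. t \<in> T \<Longrightarrow> p t \<otimes> q t \<otimes> r t = d t"
  shows "factorable G T 3 d"
  unfolding factorable_def
proof (intro exI[of _ "\<lambda>i. if i = 0 then p else if i = 1 then q else r"] conjI allI ballI impI)
  fix t assume t: "t \<in> T"
  then have "p t \<in> carrier G" using assms(1) by (auto simp: bij_betw_def)
  then show "layer_prod G (\<lambda>i. if i = 0 then p else if i = 1 then q else r) 3 t = d t"
    using assms(4)[OF t] by (simp add: numeral_3_eq_3)
qed (use assms in auto)

text \<open>The hypotheses on \<open>p\<close> describe a complete mapping: every \<open>y\<close>
  is \<open>p x \<otimes> x\<close> for exactly one \<open>x = \<zeta> y\<close>. Writing the last
  layer in this way splits it into two bijective layers with the same product.\<close>

lemma factorable_Suc:
  assumes p: "bij_betw p (carrier G) (carrier G)"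
    and e: "bij_betw (\<lambda>x. p x \<otimes> x) (carrier G) (carrier G)"
    and g: "g \<ge> 1" and F: "factorable G T g d"
  shows "factorable G T (Suc g) d"
proof -
  obtain h where h: "g = Suc h" using g by (cases g) auto
  obtain s where s: "\<And>i. i < g \<Longrightarrow> bij_betw (s i) T (carrier G)"
    and d: "\<And>t. t \<in> T \<Longrightarrow> layer_prod G s g t = d t"
    using F by (auto simp: factorable_def)
  define \<zeta> where "\<zeta> = inv_into (carrier G) (\<lambda>x. p x \<otimes> x)"
  have \<zeta>: "bij_betw \<zeta> (carrier G) (carrier G)"
    using e unfolding \<zeta>_def by (rule bij_betw_inv_into)
  have \<zeta>_eq: "p (\<zeta> y) \<otimes> \<zeta> y = y" if "y \<in> carrier G" for y
    using bij_betw_inv_into_right[OF e that] by (simp add: \<zeta>_def)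
  define s' where "s' i = (if i < h then s i else if i = h then p \<circ> (\<zeta> \<circ> s h) else \<zeta> \<circ> s h)" for i
  have zs: "bij_betw (\<zeta> \<circ> s h) T (carrier G)"
    using bij_betw_trans[OF s \<zeta>] h by auto
  have "bij_betw (s' i) T (carrier G)" if "i < Suc g" for i
    using that s h zs bij_betw_trans[OF zs p] by (auto simp: s'_def)
  moreover have "layer_prod G s' (Suc g) t = d t" if t: "t \<in> T" for t
  proof -
    have sc: "s i t \<in> carrier G" if "i < g" for i using s[OF that] t by (auto simp: bij_betw_def)
    have L: "layer_prod G s h t \<in> carrier G"
      using layer_prod_closed[of h s t] sc h by auto
    have y: "s h t \<in> carrier G" using sc h by auto
    have zc: "\<zeta> (s h t) \<in> carrier G" "p (\<zeta> (s h t)) \<in> carrier G"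
      using y \<zeta> p by (auto simp: bij_betw_def)
    have "layer_prod G s' h t = layer_prod G s h t"
      by (rule layer_prod_cong) (simp add: s'_def)
    then have "layer_prod G s' (Suc g) t = layer_prod G s h t \<otimes> p (\<zeta> (s h t)) \<otimes> \<zeta> (s h t)"
      by (simp add: h s'_def)
    also have "\<dots> = layer_prod G s g t"
      using \<zeta>_eq[OF y] L zc by (simp add: m_assoc h)
    finally show ?thesis using d[OF t] by simp
  qed
  ultimately show ?thesis unfolding factorable_def by blast
qed

lemma factorable_ge:
  assumes p: "bij_betw p (carrier G) (carrier G)"
    and e: "bij_betw (\<lambda>x. p x \<otimes> x) (carrier G) (carrier G)"
    and g: "g \<ge> 1" and F: "factorable G T g d" and "g \<le> g'"
  shows "factorable G T g' d"
  using \<open>g \<le> g'\<close>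
proof (induction g' rule: dec_induct)
  case (step n)
  then show ?case using factorable_Suc[OF p e, of n] g by simp
qed (rule F)

text \<open>The factor \<open>c\<close> is absorbed into the last layer, which a right translation
  keeps bijective.\<close>

lemma factorable_mult_right:
  assumes g: "g \<ge> 1" and F: "factorable G T g d" and c: "c \<in> carrier G"
  shows "factorable G T g (\<lambda>t. d t \<otimes> c)"
proof -
  obtain h where h: "g = Suc h" using g by (cases g) auto
  obtain s where s: "\<And>i. i < g \<Longrightarrow> bij_betw (s i) T (carrier G)"
    and d: "\<And>t. t \<in> T \<Longrightarrow> layer_prod G s g t = d t"
    using F by (auto simp: factorable_def)
  define s' where "s' i = (if i < h then s i else (\<lambda>x. x \<otimes> c) \<circ> s h)" for i
  have "bij_betw (\<lambda>x. x \<otimes> c) (carrier G) (carrier G)"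
    using c by (intro bij_betw_byWitness[of _ "\<lambda>x. x \<otimes> inv c"]) (auto simp: m_assoc)
  then have "bij_betw (s' i) T (carrier G)" if "i < g" for i
    using that s h bij_betw_trans[OF s[of h]] by (auto simp: s'_def)
  moreover have "layer_prod G s' g t = d t \<otimes> c" if t: "t \<in> T" for t
  proof -
    have sc: "s i t \<in> carrier G" if "i < g" for i using s[OF that] t by (auto simp: bij_betw_def)
    have L: "layer_prod G s h t \<in> carrier G"
      using layer_prod_closed[of h s t] sc h by auto
    have "layer_prod G s' h t = layer_prod G s h t"
      by (rule layer_prod_cong) (simp add: s'_def)
    then show ?thesis using L sc[of h] c d[OF t] by (simp add: h s'_def flip: m_assoc)
  qed
  ultimately show ?thesis unfolding factorable_def by blast
qed

lemma factorable_iso: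
  assumes F: "factorable G T g d" and "\<phi> \<in> iso G G"
  shows "factorable G T g (\<lambda>t. \<phi> (d t))"
proof -
  have hom: "\<phi> \<in> hom G G" and bij: "bij_betw \<phi> (carrier G) (carrier G)"
    using assms(2) by (auto simp: iso_def)
  obtain s where s: "\<And>i. i < g \<Longrightarrow> bij_betw (s i) T (carrier G)"
    and d: "\<And>t. t \<in> T \<Longrightarrow> layer_prod G s g t = d t"
    using F by (auto simp: factorable_def)
  have "layer_prod G (\<lambda>i. \<phi> \<circ> s i) k t = \<phi> (layer_prod G s k t)" if t: "t \<in> T" and "k \<le> g" for t k
    using that(2)
  proof (induction k)
    case 0
    then show ?case using hom hom_one is_group by fastforce
  next
    case (Suc k)
    have sc: "s i t \<in> carrier G" if "i < g" for i using s[OF that] t by (auto simp: bij_betw_def)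
    have "layer_prod G s k t \<in> carrier G" "s k t \<in> carrier G"
      using layer_prod_closed[of k s t] sc Suc.prems by auto
    then show ?case using Suc hom by (simp add: hom_mult)
  qed
  then have "\<And>t. t \<in> T \<Longrightarrow> layer_prod G (\<lambda>i. \<phi> \<circ> s i) g t = \<phi> (d t)" using d by simp
  moreover have "bij_betw (\<phi> \<circ> s i) T (carrier G)" if "i < g" for i
    using bij_betw_trans[OF s[OF that] bij] .
  ultimately show ?thesis unfolding factorable_def by (intro exI[of _ "\<lambda>i. \<phi> \<circ> s i"]) auto
qed

text \<open>With vertices numbered by \<open>\<phi>\<close>, the layer permutations are right
  translations by \<open>s i t\<close>. The return map is right translation by \<open>d t\<close>,
  all of whose orbits have the order of \<open>d t\<close> as length; \<open>S1\<close> and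
  \<open>S2\<close> fix this order.\<close>

lemma HWP_of_factorable:
  assumes fin: "finite (carrier G)" and u: "card (carrier G) = u" and g: "g \<ge> 3"
    and F: "factorable G T g d" and S: "S \<subseteq> T" "card S = \<alpha>" "card (T - S) = \<beta>"
    and l: "l \<ge> 1" "l' \<ge> 1"
    and S1: "\<And>t r. t \<in> S \<Longrightarrow> d t [^] (r::nat) = \<one> \<longleftrightarrow> l dvd r"
    and S2: "\<And>t r. t \<in> T - S \<Longrightarrow> d t [^] (r::nat) = \<one> \<longleftrightarrow> l' dvd r"
  shows "HWP (Cg_blowup g u) (g * l) (g * l') \<alpha> \<beta>"
proof -
  obtain s where s: "\<And>i. i < g \<Longrightarrow> bij_betw (s i) T (carrier G)"
    and d: "\<And>t. t \<in> T \<Longrightarrow> layer_prod G s g t = d t"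
    using F by (auto simp: factorable_def)
  obtain \<phi> where \<phi>: "bij_betw \<phi> (carrier G) {..<u}"
    using ex_bij_betw_finite_nat[OF fin] u by (auto simp: lessThan_atLeast0)
  define \<psi> where "\<psi> = inv_into (carrier G) \<phi>"
  have \<psi>: "bij_betw \<psi> {..<u} (carrier G)"
    using \<phi> unfolding \<psi>_def by (rule bij_betw_inv_into)
  have \<phi>\<psi>: "\<phi> (\<psi> a) = a" if "a < u" for a
    using that \<phi> unfolding \<psi>_def by (meson bij_betw_inv_into_right lessThan_iff)
  have \<psi>\<phi>: "\<psi> (\<phi> x) = x" if "x \<in> carrier G" for x
    using that \<phi> unfolding \<psi>_def by (meson bij_betw_inv_into_left)
  have \<psi>c: "\<psi> a \<in> carrier G" if "a < u" for a using \<psi> that by (auto simp: bij_betw_def)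
  define \<sigma> where "\<sigma> t i a = \<phi> (\<psi> a \<otimes> s i t)" for t i a
  have sc: "s i t \<in> carrier G" if "i < g" "t \<in> T" for i t using s that by (auto simp: bij_betw_def)
  \<comment> \<open>Left translations make \<open>\<sigma> t i a\<close> bijective in
    \<open>t\<close>; right translations make it a permutation in \<open>a\<close>.\<close>
  have multl: "bij_betw (\<lambda>x. c \<otimes> x) (carrier G) (carrier G)" if "c \<in> carrier G" for c
    using that by (intro bij_betw_byWitness[of _ "\<lambda>x. inv c \<otimes> x"]) (auto simp flip: m_assoc)
  have multr: "bij_betw (\<lambda>x. x \<otimes> c) (carrier G) (carrier G)" if "c \<in> carrier G" for c
    using that by (intro bij_betw_byWitness[of _ "\<lambda>x. x \<otimes> inv c"]) (auto simp: m_assoc)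
  have latin: "bij_betw (\<lambda>t. \<sigma> t i a) T {..<u}" if "i < g" "a < u" for i a
    using bij_betw_trans[OF bij_betw_trans[OF s[OF that(1)] multl[OF \<psi>c[OF that(2)]]] \<phi>]
    by (simp add: \<sigma>_def o_def)
  have bij: "bij_betw (\<sigma> t i) {..<u} {..<u}" if "i < g" "t \<in> T" for i t
    using bij_betw_trans[OF bij_betw_trans[OF \<psi> multr[OF sc[OF that]]] \<phi>]
    by (simp add: \<sigma>_def o_def cong: bij_betw_cong)
  have lc: "layer_prod G s i t \<in> carrier G" if "t \<in> T" "i \<le> g" for t i
    using layer_prod_closed[of i s t] sc that by auto
  have comp: "layer_comp (\<sigma> t) i a = \<phi> (\<psi> a \<otimes> layer_prod G s i t)"
    if "t \<in> T" "i \<le> g" "a < u" for t i a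
    using that(2)
  proof (induction i)
    case 0
    then show ?case using that by (simp add: \<psi>c \<phi>\<psi>)
  next
    case (Suc i)
    then show ?case using that
      by (simp add: \<sigma>_def \<psi>\<phi> \<psi>c lc sc m_assoc)
  qed
  have dc: "d t \<in> carrier G" if "t \<in> T" for t using lc[OF that, of g] d[OF that] by simp
  have pow: "(layer_comp (\<sigma> t) g ^^ r) a = \<phi> (\<psi> a \<otimes> d t [^] r)" if "t \<in> T" "a < u" for t a r
  proof (induction r)
    case 0
    then show ?case using that by (simp add: \<psi>c \<phi>\<psi>)
  next
    case (Suc r)
    have c: "\<psi> a \<otimes> d t [^] r \<in> carrier G" using that by (simp add: \<psi>c dc)
    then have "\<phi> (\<psi> a \<otimes> d t [^] r) < u" using \<phi> by (auto simp: bij_betw_def)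
    then show ?case using Suc that c comp[of t g] d
      by (simp add: \<psi>\<phi> \<psi>c dc m_assoc)
  qed
  have fix_iff: "(layer_comp (\<sigma> t) g ^^ r) a = a \<longleftrightarrow> d t [^] r = \<one>" if "t \<in> T" "a < u" for t a r
  proof -
    have "(layer_comp (\<sigma> t) g ^^ r) a = a \<longleftrightarrow> \<psi> a \<otimes> d t [^] r = \<psi> a"
      using pow[OF that] \<phi>\<psi>[OF that(2)] \<psi>\<phi>[of "\<psi> a \<otimes> d t [^] r"] that by (auto simp: \<psi>c dc)
    then show ?thesis using that by (simp add: \<psi>c dc)
  qed
  have cf: "is_cycle_factor (Cg_blowup g u) (g * k) (layer_factor g u (\<sigma> t))"
    if "t \<in> T" "k \<ge> 1" "\<And>r. d t [^] (r::nat) = \<one> \<longleftrightarrow> k dvd r" for t k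
    by (rule is_cycle_factor_layer_factor[OF g that(2) _ refl])
      (use that(1,3) fix_iff bij in \<open>simp_all add: nat_dvd_not_less\<close>)
  show ?thesis
  proof (rule HWP_of_latin_layers[where \<sigma> = \<sigma>, OF g S(1) _ S(2,3) latin])
    show "finite T" using factorable_finite[OF F] fin g by simp
    show "is_cycle_factor (Cg_blowup g u) (g * l) (layer_factor g u (\<sigma> t))" if "t \<in> S" for t
      using cf[OF _ l(1) S1] that S(1) by blast
    show "is_cycle_factor (Cg_blowup g u) (g * l') (layer_factor g u (\<sigma> t))" if "t \<in> T - S" for t
      using cf[OF _ l(2) S2] that by blast
  qed
qed

text \<open>Exchanging the second-layer values at \<open>t\<close> and \<open>\<kappa> t\<close>,
  for \<open>t\<close> in a \<open>c\<close>-element subset of \<open>U\<close>, turns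
  \<open>2 * c\<close> products from \<open>\<one>\<close> into \<open>z\<close>. The products at
  \<open>S\<close> are \<open>z\<close> from the start and stay untouched.\<close>

lemma factorable_toggle:
  assumes bij: "bij_betw p T (carrier G)" "bij_betw q T (carrier G)" "bij_betw r T (carrier G)"
    and d: "\<And>t. t \<in> T \<Longrightarrow> p t \<otimes> q t \<otimes> r t = (if t \<in> S then z else \<one>)"
    and \<kappa>: "inj_on \<kappa> U" "U \<subseteq> T" "\<kappa> ` U \<subseteq> T" "U \<inter> \<kappa> ` U = {}" "finite U"
    and S: "S \<inter> (U \<union> \<kappa> ` U) = {}" "finite S" "S \<subseteq> T"
    and z: "\<And>t. t \<in> U \<Longrightarrow> p t \<otimes> q (\<kappa> t) \<otimes> r t = z"
      "\<And>t. t \<in> U \<Longrightarrow> p (\<kappa> t) \<otimes> q t \<otimes> r (\<kappa> t) = z"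
    and c: "c \<le> card U"
  shows "\<exists>S'\<subseteq>T. card S' = card S + 2 * c \<and> factorable G T 3 (\<lambda>t. if t \<in> S' then z else \<one>)"
proof -
  obtain K where K: "K \<subseteq> U" "card K = c" using obtain_subset_with_card_n[OF c] by metis
  have finK: "finite K" using K \<kappa>(5) finite_subset by blast
  \<comment> \<open>This is the involution exchanging each \<open>t \<in> K\<close> with
    \<open>\<kappa> t\<close>.\<close>
  define \<iota> where "\<iota> t = (if t \<in> K then \<kappa> t else if t \<in> \<kappa> ` K then inv_into K \<kappa> t else t)" for t
  have injK: "inj_on \<kappa> K" using \<kappa>(1) K(1) inj_on_subset by blast
  have dis: "\<kappa> t \<notin> K" if "t \<in> K" for t using \<kappa>(4) K(1) that by blast
  have \<iota>1: "\<iota> t = \<kappa> t" if "t \<in> K" for t using that by (simp add: \<iota>_def)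
  have \<iota>2: "\<iota> (\<kappa> t) = t" if "t \<in> K" for t using that dis injK by (simp add: \<iota>_def)
  have \<iota>3: "\<iota> t = t" if "t \<notin> K" "t \<notin> \<kappa> ` K" for t using that by (simp add: \<iota>_def)
  have \<iota>\<iota>: "\<iota> (\<iota> t) = t" for t
  proof -
    consider "t \<in> K" | t' where "t' \<in> K" "t = \<kappa> t'" | "t \<notin> K" "t \<notin> \<kappa> ` K" by blast
    then show ?thesis using \<iota>1 \<iota>2 \<iota>3 by cases auto
  qed
  have \<iota>T: "\<iota> t \<in> T" if "t \<in> T" for t
  proof -
    consider "t \<in> K" | t' where "t' \<in> K" "t = \<kappa> t'" | "t \<notin> K" "t \<notin> \<kappa> ` K" by blast
    then show ?thesis
      by cases (use \<iota>1 \<iota>2 \<iota>3 subsetD[OF K(1)] subsetD[OF \<kappa>(2)] \<kappa>(3) that in auto)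
  qed
  have "bij_betw \<iota> T T" by (rule bij_betw_byWitness[of _ \<iota>]) (auto simp: \<iota>\<iota> \<iota>T)
  then have q': "bij_betw (q \<circ> \<iota>) T (carrier G)" using bij(2) bij_betw_trans by blast
  let ?S = "S \<union> (K \<union> \<kappa> ` K)"
  have "p t \<otimes> (q \<circ> \<iota>) t \<otimes> r t = (if t \<in> ?S then z else \<one>)" if "t \<in> T" for t
  proof (cases "t \<in> K \<union> \<kappa> ` K")
    case True
    then consider "t \<in> K" | t' where "t' \<in> K" "t = \<kappa> t'" by blast
    then show ?thesis by cases (use z \<iota>1 \<iota>2 subsetD[OF K(1)] in auto)
  next
    case False
    then show ?thesis using d[OF that] \<iota>3 by auto
  qed
  then have "factorable G T 3 (\<lambda>t. if t \<in> ?S then z else \<one>)"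
    by (rule factorable_3[OF bij(1) q' bij(3)])
  moreover have "card ?S = card S + 2 * c"
  proof -
    have "card (K \<union> \<kappa> ` K) = 2 * c"
      using K injK finK \<kappa>(4) by (subst card_Un_disjoint) (auto simp: card_image)
    moreover have "S \<inter> (K \<union> \<kappa> ` K) = {}" using S(1) K(1) by blast
    ultimately show ?thesis using S(2) finK by (subst card_Un_disjoint) auto
  qed
  moreover have "?S \<subseteq> T" using S(3) K(1) \<kappa>(2,3) by blast
  ultimately show ?thesis by blast
qed

end

section \<open>Direct products and cyclic groups of odd order\<close>

lemma factorable_DirProd:
  assumes "group G" "group H"
    and G: "\<And>y. y \<in> carrier H \<Longrightarrow> factorable G T g (d y)"
    and H: "factorable H (carrier H) g (\<lambda>_. e)"
  shows "factorable (G \<times>\<times> H) (T \<times> carrier H) g (\<lambda>(t, y). (d y t, e))"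
proof -
  obtain s where s: "\<And>y i. y \<in> carrier H \<Longrightarrow> i < g \<Longrightarrow> bij_betw (s y i) T (carrier G)"
    and d: "\<And>y t. y \<in> carrier H \<Longrightarrow> t \<in> T \<Longrightarrow> layer_prod G (s y) g t = d y t"
    using G unfolding factorable_def by metis
  obtain r where r: "\<And>i. i < g \<Longrightarrow> bij_betw (r i) (carrier H) (carrier H)"
    and e: "\<And>y. y \<in> carrier H \<Longrightarrow> layer_prod H r g y = e"
    using H unfolding factorable_def by metis
  \<comment> \<open>The layers of \<open>G\<close> may depend on \<open>y\<close>: the second
    component determines \<open>y\<close>, and then the first determines \<open>t\<close>.\<close>
  define f where "f i = (\<lambda>(t, y). (s y i t, r i y))" for i
  have "bij_betw (f i) (T \<times> carrier H) (carrier (G \<times>\<times> H))" if i: "i < g" for i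
    unfolding bij_betw_def
  proof
    show "inj_on (f i) (T \<times> carrier H)"
    proof (rule inj_onI, clarify)
      fix t y t' y' assume *: "t \<in> T" "y \<in> carrier H" "t' \<in> T" "y' \<in> carrier H"
        "f i (t, y) = f i (t', y')"
      then have "y = y'" using r[OF that] by (auto simp: f_def bij_betw_def inj_on_def)
      then show "t = t' \<and> y = y'"
        using * s[OF _ that, of y] by (auto simp: f_def bij_betw_def inj_on_def)
    qed
    show "f i ` (T \<times> carrier H) = carrier (G \<times>\<times> H)"
    proof
      show "f i ` (T \<times> carrier H) \<subseteq> carrier (G \<times>\<times> H)"
        using s[OF _ that] r[OF that] unfolding f_def bij_betw_def by auto
      show "carrier (G \<times>\<times> H) \<subseteq> f i ` (T \<times> carrier H)"
      proof
        fix w assume "w \<in> carrier (G \<times>\<times> H)"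
        then obtain a b where w: "w = (a, b)" "a \<in> carrier G" "b \<in> carrier H" by auto
        obtain y where y: "y \<in> carrier H" "b = r i y"
          using r[OF i] w by (auto simp: bij_betw_def image_def)
        obtain t where t: "t \<in> T" "a = s y i t"
          using s[OF y(1) i] w by (auto simp: bij_betw_def image_def)
        show "w \<in> f i ` (T \<times> carrier H)"
          using w y t by (auto simp: f_def image_def intro!: bexI[of _ t] bexI[of _ y])
      qed
    qed
  qed
  moreover have "layer_prod (G \<times>\<times> H) f k (t, y) = (layer_prod G (s y) k t, layer_prod H r k y)" for k t y
    by (induction k) (auto simp: f_def)
  ultimately show ?thesis
    using d e unfolding factorable_def by (intro exI[of _ f]) auto
qed

text \<open>Doubling is bijective for odd \<open>q\<close>, so the identity is a complete mapping,
  and the two layers \<open>y\<close> and \<open>1 - y\<close> can be extended to \<open>g\<close>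
  layers. The form \<open>1 mod int q\<close> covers \<open>q = 1\<close>.\<close>

lemma factorable_integer_mod_group:
  assumes "odd q" "g \<ge> 2"
  shows "factorable (integer_mod_group q) (carrier (integer_mod_group q)) g (\<lambda>_. 1 mod int q)"
proof -
  let ?Z = "integer_mod_group q"
  interpret Z: group ?Z by simp
  have q: "q > 0" using assms(1) by (rule odd_pos)
  have car: "carrier ?Z = {0..<int q}" using q by (simp add: carrier_integer_mod_group)
  have id: "bij_betw (\<lambda>x. x) (carrier ?Z) (carrier ?Z)" by (simp add: bij_betw_def)
  have "inj_on (\<lambda>x. (x + x) mod int q) {0..<int q}"
  proof (rule inj_onI)
    fix x y assume xy: "x \<in> {0..<int q}" "y \<in> {0..<int q}" "(x + x) mod int q = (y + y) mod int q"
    then have "int q dvd 2 * (x - y)" by (simp add: mod_eq_dvd_iff algebra_simps)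
    moreover have "coprime (int q) 2" using assms(1) by simp
    ultimately have "int q dvd x - y" using coprime_dvd_mult_right_iff by blast
    then have "x mod int q = y mod int q" by (simp add: mod_eq_dvd_iff)
    then show "x = y" using xy by auto
  qed
  then have dbl: "bij_betw (\<lambda>x. x \<otimes>\<^bsub>?Z\<^esub> x) (carrier ?Z) (carrier ?Z)"
    unfolding bij_betw_def car mult_integer_mod_group
    using q by (intro conjI endo_inj_surj) auto
  have "bij_betw (\<lambda>y. (1 - y) mod int q) (carrier ?Z) (carrier ?Z)"
    using q by (intro bij_betw_byWitness[of _ "\<lambda>y. (1 - y) mod int q"])
      (auto simp: car mod_simps)
  then have "factorable ?Z (carrier ?Z) 2 (\<lambda>_. 1 mod int q)"
    unfolding factorable_def
    by (intro exI[of _ "\<lambda>i y. if i = 0 then y else (1 - y) mod int q"])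
      (use id in \<open>auto simp: numeral_2_eq_2 less_Suc_eq mod_simps\<close>)
  then show ?thesis using Z.factorable_ge[OF id dbl _ _ assms(2)] by auto
qed

section \<open>The dihedral group\<close>

text \<open>The pair \<open>(s, a)\<close> stands for \<open>r\<^sup>a\<close> if \<open>s\<close> is false and for the reflection \<open>r\<^sup>a f\<close> if \<open>s\<close> is
  true, where \<open>f r f = r\<^sup>-\<^sup>1\<close>.\<close>

definition dihedral :: "int \<Rightarrow> (bool \<times> int) monoid" where
  "dihedral N = \<lparr>carrier = UNIV \<times> {0..<N},
     monoid.mult = (\<lambda>(s, a) (t, b). (s \<noteq> t, (if s then a - b else a + b) mod N)),
     one = (False, 0)\<rparr>"

lemma carrier_dihedral: "carrier (dihedral N) = UNIV \<times> {0..<N}"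
  by (simp add: dihedral_def)

lemma one_dihedral [simp]: "\<one>\<^bsub>dihedral N\<^esub> = (False, 0)"
  by (simp add: dihedral_def)

lemma mult_dihedral [simp]:
  "(s, a) \<otimes>\<^bsub>dihedral N\<^esub> (t, b) = (s \<noteq> t, (if s then a - b else a + b) mod N)"
  by (simp add: dihedral_def)

lemma group_dihedral:
  assumes "N > 0"
  shows "group (dihedral N)"
proof (rule groupI)
  fix x y z assume "x \<in> carrier (dihedral N)" "y \<in> carrier (dihedral N)" "z \<in> carrier (dihedral N)"
  then show "x \<otimes>\<^bsub>dihedral N\<^esub> y \<otimes>\<^bsub>dihedral N\<^esub> z = x \<otimes>\<^bsub>dihedral N\<^esub> (y \<otimes>\<^bsub>dihedral N\<^esub> z)"
    by (cases x; cases y; cases z) (auto simp: mod_simps algebra_simps)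
next
  fix x assume "x \<in> carrier (dihedral N)"
  then show "\<exists>y\<in>carrier (dihedral N). y \<otimes>\<^bsub>dihedral N\<^esub> x = \<one>\<^bsub>dihedral N\<^esub>"
    using assms
    by (intro bexI[of _ "(fst x, (if fst x then snd x else - snd x) mod N)"])
      (auto simp: carrier_dihedral mod_simps)
qed (use assms in \<open>auto simp: carrier_dihedral\<close>)

lemma pow_dihedral:
  assumes "N > 0" "a \<in> {0..<N}"
  shows "(False, a) [^]\<^bsub>dihedral N\<^esub> (r::nat) = (False, (int r * a) mod N)"
proof -
  interpret group "dihedral N" using group_dihedral assms(1) .
  show ?thesis by (induction r) (auto simp: mod_simps algebra_simps)
qed

text \<open>This is conjugation by the reflection \<open>f\<close>. It inverts \<open>r^2\<close>,
  so that followed by translation by \<open>r^2\<close> it exchanges the products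
  \<open>\<one>\<close> and \<open>r^2\<close>.\<close>

lemma dihedral_neg_iso:
  assumes "N > 0"
  shows "(\<lambda>(s, a). (s, (- a) mod N)) \<in> iso (dihedral N) (dihedral N)"
proof -
  have "bij_betw (\<lambda>(s::bool, a). (s, (- a) mod N)) (UNIV \<times> {0..<N}) (UNIV \<times> {0..<N})"
    using assms by (intro bij_betw_byWitness[of _ "\<lambda>(s, a). (s, (- a) mod N)"]) (auto simp: mod_simps)
  then show ?thesis
    using assms by (auto simp: iso_def hom_def carrier_dihedral mod_simps algebra_simps)
qed

lemma mod_eq_close:
  fixes x y N :: int
  assumes "x mod N = y mod N" "\<bar>x - y\<bar> < 2 * N"
  shows "x = y \<or> x = y + N \<or> y = x + N"
proof -
  obtain k where k: "x - y = N * k" using assms(1) by (metis mod_eq_dvd_iff dvdE)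
  have N: "N > 0" using assms(2) by linarith
  have "\<bar>k\<bar> < 2" using assms(2) N unfolding k
    by (simp add: abs_mult)
  then have "k = 0 \<or> k = 1 \<or> k = -1" by linarith
  then show ?thesis using k by auto
qed

context group
begin

text \<open>Start from the layers \<open>p\<close>, \<open>id\<close>, \<open>inverse of p t \<otimes> t\<close>, all of whose products are \<open>\<one>\<close>. Swapping the
  second layer at \<open>t\<close> and \<open>\<kappa> t\<close> turns two products into \<open>z\<close>. Swapping \<open>X, Y\<close> in the first, \<open>X, W\<close> in
  the second and \<open>Y, W\<close> in the third layer turns just one product into \<open>z\<close>, which fixes the parity;
  in an abelian group the equations on \<open>X, Y, W\<close> would force \<open>z = \<one>\<close>.\<close>

lemma complete_mapping_toggles:
  assumes fin: "finite (carrier G)"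
    and p: "bij_betw p (carrier G) (carrier G)"
    and e: "bij_betw (\<lambda>t. p t \<otimes> t) (carrier G) (carrier G)"
    and z: "z \<in> carrier G"
    and U: "U \<subseteq> carrier G" "inj_on \<kappa> U" "\<kappa> ` U \<subseteq> carrier G" "U \<inter> \<kappa> ` U = {}"
    and \<kappa>: "\<And>t. t \<in> U \<Longrightarrow> p t \<otimes> \<kappa> t = z \<otimes> (p t \<otimes> t)"
      "\<And>t. t \<in> U \<Longrightarrow> p (\<kappa> t) \<otimes> t = z \<otimes> (p (\<kappa> t) \<otimes> \<kappa> t)"
    and XYW: "X \<in> carrier G" "Y \<in> carrier G" "W \<in> carrier G" "X \<noteq> Y" "X \<noteq> W" "Y \<noteq> W"
    and eqs: "p Y \<otimes> W = p X \<otimes> X" "p X \<otimes> Y = p W \<otimes> W" "p W \<otimes> X = z \<otimes> (p Y \<otimes> Y)"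
    and U': "U' \<subseteq> U" "{X, Y, W} \<inter> (U' \<union> \<kappa> ` U') = {}"
    and c: "c \<le> 2 * card U" "odd c \<Longrightarrow> c \<le> 2 * card U' + 1"
  shows "\<exists>S\<subseteq>carrier G. card S = c \<and> factorable G (carrier G) 3 (\<lambda>t. if t \<in> S then z else \<one>)"
proof -
  define r where "r t = inv (p t \<otimes> t)" for t
  let ?T = "carrier G"
  have pc: "p t \<in> ?T" if "t \<in> ?T" for t using p that by (auto simp: bij_betw_def)
  have inv: "bij_betw (\<lambda>x. inv x) ?T ?T"
    by (rule bij_betw_byWitness[of _ "\<lambda>x. inv x"]) auto
  have r: "bij_betw r ?T ?T"
    using bij_betw_trans[OF e inv] by (simp add: r_def o_def cong: bij_betw_cong)
  have id: "bij_betw (\<lambda>x. x) ?T ?T" by (simp add: bij_betw_def)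
  have finU: "finite U" "finite U'" using U U' fin by (meson finite_subset)+
  have r1: "p t \<otimes> t \<otimes> r t = \<one>" if "t \<in> ?T" for t using that pc by (simp add: r_def)
  have cancel: "a \<otimes> b \<otimes> r t = \<one>" if "a \<otimes> b = p t \<otimes> t" "t \<in> ?T" for a b t
    using that pc by (simp add: r_def)
  have cancel_z: "a \<otimes> b \<otimes> r t = z" if "a \<otimes> b = z \<otimes> (p t \<otimes> t)" "t \<in> ?T" for a b t
    using that pc z by (simp add: r_def m_assoc)
  have Uc: "t \<in> ?T" "\<kappa> t \<in> ?T" if "t \<in> U" for t using U that by auto
  show ?thesis
  proof (cases "even c")
    case True
    then obtain c' where c': "c = 2 * c'" by (elim evenE)
    show ?thesis
      using factorable_toggle[OF p id r, of "{}" z \<kappa> U c'] r1 \<kappa> cancel_z Uc U finU c' c(1) by simp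
  next
    case False
    then obtain c' where c': "c = 2 * c' + 1" by (elim oddE)
    define tp where "tp = (\<lambda>t. if t = X then Y else if t = Y then X else t)"
    define tq where "tq = (\<lambda>t. if t = X then W else if t = W then X else t)"
    define tr where "tr = (\<lambda>t. if t = Y then W else if t = W then Y else t)"
    have bij_t: "bij_betw tp ?T ?T" "bij_betw tq ?T ?T" "bij_betw tr ?T ?T"
      by (rule bij_betw_byWitness[of _ tp], use XYW in \<open>auto simp: tp_def\<close>)
        (rule bij_betw_byWitness[of _ tq], use XYW in \<open>auto simp: tq_def\<close>,
         rule bij_betw_byWitness[of _ tr], use XYW in \<open>auto simp: tr_def\<close>)
    have bij': "bij_betw (p \<circ> tp) ?T ?T" "bij_betw tq ?T ?T" "bij_betw (r \<circ> tr) ?T ?T"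
      using bij_t bij_betw_trans p r by blast+
    \<comment> \<open>After the swaps the products at \<open>X\<close>, \<open>Y\<close>,
      \<open>W\<close> involve \<open>r X\<close>, \<open>r W\<close>, \<open>r Y\<close>; the three
      equations \<open>eqs\<close> evaluate them in this order.\<close>
    have d: "(p \<circ> tp) t \<otimes> tq t \<otimes> (r \<circ> tr) t = (if t \<in> {W} then z else \<one>)" if "t \<in> ?T" for t
    proof -
      consider "t = X" | "t = Y" | "t = W" | "t \<notin> {X, Y, W}" by blast
      then show ?thesis
      proof cases
        case 1 then show ?thesis using XYW cancel[OF eqs(1)] by (simp add: tp_def tq_def tr_def)
      next
        case 2 then show ?thesis using XYW cancel[OF eqs(2)] by (simp add: tp_def tq_def tr_def)
      next
        case 3 then show ?thesis using XYW cancel_z[OF eqs(3)] by (auto simp: tp_def tq_def tr_def)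
      next
        case 4 then show ?thesis using r1[OF that] by (simp add: tp_def tq_def tr_def)
      qed
    qed
    have fixed: "tp t = t" "tq t = t" "tr t = t" if "t \<notin> {X, Y, W}" for t
      using that by (auto simp: tp_def tq_def tr_def)
    have U'c: "t \<in> U" "t \<notin> {X, Y, W}" "\<kappa> t \<notin> {X, Y, W}" if "t \<in> U'" for t
      using that U' by auto
    have "\<exists>S\<subseteq>?T. card S = card {W} + 2 * c' \<and> factorable G ?T 3 (\<lambda>t. if t \<in> S then z else \<one>)"
    proof (rule factorable_toggle[OF bij' d])
      show "inj_on \<kappa> U'" using U(2) U'(1) inj_on_subset by blast
      show "(p \<circ> tp) t \<otimes> tq (\<kappa> t) \<otimes> (r \<circ> tr) t = z" if "t \<in> U'" for t
        using U'c[OF that] fixed cancel_z[OF \<kappa>(1)] Uc by simp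
      show "(p \<circ> tp) (\<kappa> t) \<otimes> tq t \<otimes> (r \<circ> tr) (\<kappa> t) = z" if "t \<in> U'" for t
        using U'c[OF that] fixed cancel_z[OF \<kappa>(2)] Uc by simp
      show "c' \<le> card U'" using c(2) False c' by simp
      show "\<kappa> ` U' \<subseteq> ?T" "U' \<inter> \<kappa> ` U' = {}" using U U'(1) by blast+
    qed (use U U' XYW finU in auto)
    then show ?thesis using c' by simp
  qed
qed

end

section \<open>Complete mappings of dihedral groups\<close>

definition reduce :: "int \<Rightarrow> (bool \<times> int \<Rightarrow> bool \<times> int) \<Rightarrow> bool \<times> int \<Rightarrow> bool \<times> int" where
  "reduce N m t = (fst (m t), snd (m t) mod N)"

text \<open>The exponent of \<open>m t \<otimes> t\<close> is left unreduced, so that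
  \<open>inj_mod\<close> applies to it as it does to \<open>m\<close>.\<close>

definition times_arg :: "(bool \<times> int \<Rightarrow> bool \<times> int) \<Rightarrow> bool \<times> int \<Rightarrow> bool \<times> int" where
  "times_arg m t = (fst (m t) \<noteq> fst t, if fst (m t) then snd (m t) - snd t else snd (m t) + snd t)"

text \<open>The bound \<open>2 * N\<close> leaves only three ways for two values to agree modulo \<open>N\<close>, so that injectivity
  of \<open>reduce N m\<close> becomes a question of linear arithmetic.\<close>

definition inj_mod :: "int \<Rightarrow> (bool \<times> int \<Rightarrow> bool \<times> int) \<Rightarrow> bool" where
  "inj_mod N m \<longleftrightarrow> (\<forall>s b s' b'. 0 \<le> b \<and> b < N \<and> 0 \<le> b' \<and> b' < N \<and> fst (m (s, b)) = fst (m (s', b')) \<longrightarrow>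
     \<bar>snd (m (s, b)) - snd (m (s', b'))\<bar> < 2 * N \<and>
     (snd (m (s, b)) = snd (m (s', b')) \<or> snd (m (s, b)) = snd (m (s', b')) + N \<longrightarrow> s = s' \<and> b = b'))"

lemma bij_betw_reduce:
  assumes "N > 0" "inj_mod N m"
  shows "bij_betw (reduce N m) (carrier (dihedral N)) (carrier (dihedral N))"
proof -
  let ?C = "carrier (dihedral N)"
  have "inj_on (reduce N m) ?C"
  proof (rule inj_onI, clarify)
    fix s b s' b' assume "(s, b) \<in> ?C" "(s', b') \<in> ?C" and eq: "reduce N m (s, b) = reduce N m (s', b')"
    then have r: "0 \<le> b" "b < N" "0 \<le> b'" "b' < N" by (auto simp: carrier_dihedral)
    have f: "fst (m (s, b)) = fst (m (s', b'))" and e: "snd (m (s, b)) mod N = snd (m (s', b')) mod N"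
      using eq by (auto simp: reduce_def)
    note inj = assms(2)[unfolded inj_mod_def, rule_format]
    have "snd (m (s, b)) = snd (m (s', b')) \<or> snd (m (s, b)) = snd (m (s', b')) + N \<or>
        snd (m (s', b')) = snd (m (s, b)) + N"
      using mod_eq_close[OF e] inj[of b b' s s'] r f by blast
    \<comment> \<open>\<open>inj_mod\<close> excludes a shift by \<open>N\<close> in one direction;
      its instance with the arguments exchanged excludes the other.\<close>
    then show "s = s' \<and> b = b'"
      using inj[of b b' s s'] inj[of b' b s' s] r f by auto
  qed
  moreover have "reduce N m ` ?C \<subseteq> ?C" "finite ?C"
    using assms(1) by (auto simp: reduce_def carrier_dihedral)
  ultimately show ?thesis by (simp add: bij_betw_def endo_inj_surj)
qed

lemma reduce_mult:
  "reduce N m t \<otimes>\<^bsub>dihedral N\<^esub> (s, b) =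
     (fst (m t) \<noteq> s, (if fst (m t) then snd (m t) - b else snd (m t) + b) mod N)"
  by (simp add: reduce_def mod_simps)

lemma reduce_times_arg:
  "reduce N m t \<otimes>\<^bsub>dihedral N\<^esub> t = reduce N (times_arg m) t"
  by (cases t) (auto simp: reduce_mult times_arg_def reduce_def[of N "times_arg m"])

text \<open>Complete mappings for \<open>N = 4 * h\<close> and \<open>N = 4 * h + 2\<close> before reduction modulo \<open>N\<close>. On each residue
  class modulo 4 the exponents form an arithmetic progression of step 2, arranged such that the
  progressions in \<open>m t\<close> and in \<open>m t \<otimes> t\<close> tile the even and the odd residues modulo \<open>N\<close>. An argument
  with a rotation as value and its shift by 2 with a reflection as value form a pair that can be
  swapped.\<close>

definition quarter_map :: "int \<Rightarrow> bool \<times> int \<Rightarrow> bool \<times> int" where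
  "quarter_map h t = (let b = snd t; j = b div 4; c = b mod 4 in
     if fst t
     then if c = 0 then (False, - 2 * j - 1) else if c = 1 then (False, - 2 * j - 1 - 2 * h)
       else if c = 2 then (True, 2 * h + 3 + 2 * j) else (True, 2 * j + 3)
     else if c = 0 then (False, 2 - 2 * j) else if c = 1 then (False, 2 - 2 * j - 2 * h)
       else if c = 2 then (True, 2 * h + 2 * j) else (True, 2 * j))"

definition odd_half_map :: "int \<Rightarrow> bool \<times> int \<Rightarrow> bool \<times> int" where
  "odd_half_map h t = (let b = snd t; j = b div 4; c = b mod 4 in
     if fst t
     then if b = 0 then (False, 1) else if b = 1 then (True, 2 + 2 * h)
       else if c = 0 then (True, 2 * j + 2 * h + 2) else if c = 1 then (False, 1 - 2 * j)
       else if c = 2 then (False, 2 * h + 1 - 2 * j) else (True, 2 + 2 * j)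
     else if b = 0 then (False, 0)
       else if c = 0 then (True, 2 * h + 3 + 2 * j) else if c = 1 then (True, 2 * j + 3)
       else if c = 2 then (False, 2 * h - 2 * j) else (False, - 2 - 2 * j))"

lemma div_mod_4 [simp]:
  fixes j :: int
  shows "(4 * j + 1) div 4 = j" "(4 * j + 2) div 4 = j" "(4 * j + 3) div 4 = j"
    "(4 * j + 1) mod 4 = 1" "(4 * j + 2) mod 4 = 2" "(4 * j + 3) mod 4 = 3"
  by presburger+

lemma quarter_map_simps:
  "quarter_map h (False, 4 * j) = (False, 2 - 2 * j)"
  "quarter_map h (False, 4 * j + 1) = (False, 2 - 2 * j - 2 * h)"
  "quarter_map h (False, 4 * j + 2) = (True, 2 * h + 2 * j)"
  "quarter_map h (False, 4 * j + 3) = (True, 2 * j)"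
  "quarter_map h (True, 4 * j) = (False, - 2 * j - 1)"
  "quarter_map h (True, 4 * j + 1) = (False, - 2 * j - 1 - 2 * h)"
  "quarter_map h (True, 4 * j + 2) = (True, 2 * h + 3 + 2 * j)"
  "quarter_map h (True, 4 * j + 3) = (True, 2 * j + 3)"
  by (simp_all add: quarter_map_def)

lemma odd_half_map_simps:
  "odd_half_map h (False, 0) = (False, 0)"
  "odd_half_map h (False, 1) = (True, 3)"
  "1 \<le> j \<Longrightarrow> odd_half_map h (False, 4 * j) = (True, 2 * h + 3 + 2 * j)"
  "1 \<le> j \<Longrightarrow> odd_half_map h (False, 4 * j + 1) = (True, 2 * j + 3)"
  "0 \<le> j \<Longrightarrow> odd_half_map h (False, 4 * j + 2) = (False, 2 * h - 2 * j)"
  "0 \<le> j \<Longrightarrow> odd_half_map h (False, 4 * j + 3) = (False, - 2 - 2 * j)"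
  "odd_half_map h (True, 0) = (False, 1)"
  "odd_half_map h (True, 1) = (True, 2 + 2 * h)"
  "1 \<le> j \<Longrightarrow> odd_half_map h (True, 4 * j) = (True, 2 * j + 2 * h + 2)"
  "1 \<le> j \<Longrightarrow> odd_half_map h (True, 4 * j + 1) = (False, 1 - 2 * j)"
  "0 \<le> j \<Longrightarrow> odd_half_map h (True, 4 * j + 2) = (False, 2 * h + 1 - 2 * j)"
  "0 \<le> j \<Longrightarrow> odd_half_map h (True, 4 * j + 3) = (True, 2 + 2 * j)"
  by (auto simp: odd_half_map_def)

lemma quarter_cases:
  fixes b h :: int
  assumes "0 \<le> b" "b < 4 * h"
  obtains j where "b = 4 * j" "0 \<le> j" "j + 1 \<le> h" | j where "b = 4 * j + 1" "0 \<le> j" "j + 1 \<le> h"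
    | j where "b = 4 * j + 2" "0 \<le> j" "j + 1 \<le> h" | j where "b = 4 * j + 3" "0 \<le> j" "j + 1 \<le> h"
proof -
  have "\<exists>j. (b = 4 * j \<or> b = 4 * j + 1 \<or> b = 4 * j + 2 \<or> b = 4 * j + 3) \<and> 0 \<le> j \<and> j + 1 \<le> h"
    using assms by (intro exI[of _ "b div 4"]) presburger
  then show ?thesis using that by blast
qed

lemma odd_half_cases:
  fixes b h :: int
  assumes "0 \<le> b" "b < 4 * h + 2"
  obtains "b = 0" | "b = 1"
    | j where "b = 4 * j" "1 \<le> j" "j \<le> h" | j where "b = 4 * j + 1" "1 \<le> j" "j \<le> h"
    | j where "b = 4 * j + 2" "0 \<le> j" "j + 1 \<le> h" | j where "b = 4 * j + 3" "0 \<le> j" "j + 1 \<le> h"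
proof -
  have "b = 0 \<or> b = 1 \<or> (\<exists>j. (b = 4 * j \<or> b = 4 * j + 1) \<and> 1 \<le> j \<and> j \<le> h \<or>
     (b = 4 * j + 2 \<or> b = 4 * j + 3) \<and> 0 \<le> j \<and> j + 1 \<le> h)"
    using assms by (intro disjCI exI[of _ "b div 4"]) presburger
  then show ?thesis using that by blast
qed

text \<open>This and the next lemma serve the cases below in which two exponents are separated by
  parity rather than by size.\<close>

lemma parity_neq: "even x \<noteq> even y \<Longrightarrow> x \<noteq> (y :: int)"
  by blast

lemma parity_contr: "x = (y :: int) \<Longrightarrow> even x \<noteq> even y \<Longrightarrow> R"
  by blast

lemma inj_mod_quarter_map: "inj_mod (4 * h) (quarter_map h)"
  unfolding inj_mod_def
proof (intro allI impI, elim conjE, goal_cases)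
  case (1 s b s' b')
  note f = 1(5)
  show ?case
    by (rule quarter_cases[OF 1(1,2)]; rule quarter_cases[OF 1(3,4)]; cases s; cases s';
        use f in \<open>simp add: quarter_map_simps\<close>;
        (intro conjI impI)?; (elim disjE)?;
        (linarith | (rule parity_neq; simp; fail) | (erule parity_contr; simp; fail)))
qed

lemma inj_mod_times_quarter_map: "inj_mod (4 * h) (times_arg (quarter_map h))"
  unfolding inj_mod_def
proof (intro allI impI, elim conjE, goal_cases)
  case (1 s b s' b')
  note f = 1(5)
  show ?case
    by (rule quarter_cases[OF 1(1,2)]; rule quarter_cases[OF 1(3,4)]; cases s; cases s';
        use f in \<open>simp add: quarter_map_simps times_arg_def\<close>;
        (intro conjI impI)?; (elim disjE)?;
        (linarith | (rule parity_neq; simp; fail) | (erule parity_contr; simp; fail)))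
qed

lemma inj_mod_odd_half_map:
  assumes h: "h \<ge> 0"
  shows "inj_mod (4 * h + 2) (odd_half_map h)"
  unfolding inj_mod_def
proof (intro allI impI, elim conjE, goal_cases)
  case (1 s b s' b')
  note f = 1(5)
  show ?case
    by (rule odd_half_cases[OF 1(1,2)]; rule odd_half_cases[OF 1(3,4)]; cases s; cases s';
        use f h in \<open>simp add: odd_half_map_simps\<close>;
        (intro conjI impI)?; (elim disjE)?;
        (linarith | (rule parity_neq; simp; fail) | (erule parity_contr; simp; fail)))
qed

lemma inj_mod_times_odd_half_map:
  assumes h: "h \<ge> 0"
  shows "inj_mod (4 * h + 2) (times_arg (odd_half_map h))"
  unfolding inj_mod_def
proof (intro allI impI, elim conjE, goal_cases)
  case (1 s b s' b')
  note f = 1(5)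
  show ?case
    by (rule odd_half_cases[OF 1(1,2)]; rule odd_half_cases[OF 1(3,4)]; cases s; cases s';
        use f h in \<open>simp add: odd_half_map_simps times_arg_def\<close>;
        (intro conjI impI)?; (elim disjE)?;
        (linarith | (rule parity_neq; simp; fail) | (erule parity_contr; simp; fail)))
qed

section \<open>Dihedral groups: prescribed numbers of products \<open>r^2\<close>\<close>

definition shift2 :: "int \<Rightarrow> bool \<times> int \<Rightarrow> bool \<times> int" where
  "shift2 N t = (fst t, (snd t + 2) mod N)"

text \<open>\<open>shift2 N\<close> is left multiplication by \<open>r^2\<close>. The rotation at
  \<open>t\<close> commutes with \<open>r^2\<close>, and the reflection at the shifted argument
  inverts it; in both cases exchanging the arguments contributes a factor \<open>r^2\<close> on the
  left.\<close>

lemma dihedral_toggles: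
  fixes N :: int
  assumes N: "N > 0" and m: "inj_mod N m" "inj_mod N (times_arg m)"
    and U: "U \<subseteq> carrier (dihedral N)" "\<And>t. t \<in> U \<Longrightarrow> \<not> fst (m t)"
      "\<And>t. t \<in> U \<Longrightarrow> fst (m (shift2 N t))"
    and XYW: "X \<in> carrier (dihedral N)" "Y \<in> carrier (dihedral N)" "W \<in> carrier (dihedral N)"
      "X \<noteq> Y" "X \<noteq> W" "Y \<noteq> W"
    and eqs: "reduce N m Y \<otimes>\<^bsub>dihedral N\<^esub> W = reduce N m X \<otimes>\<^bsub>dihedral N\<^esub> X"
      "reduce N m X \<otimes>\<^bsub>dihedral N\<^esub> Y = reduce N m W \<otimes>\<^bsub>dihedral N\<^esub> W"
      "reduce N m W \<otimes>\<^bsub>dihedral N\<^esub> X =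
         (False, 2 mod N) \<otimes>\<^bsub>dihedral N\<^esub> (reduce N m Y \<otimes>\<^bsub>dihedral N\<^esub> Y)"
    and U': "U' \<subseteq> U" "{X, Y, W} \<inter> (U' \<union> shift2 N ` U') = {}"
    and c: "c \<le> 2 * card U" "odd c \<Longrightarrow> c \<le> 2 * card U' + 1"
  shows "\<exists>S\<subseteq>carrier (dihedral N). card S = c \<and>
    factorable (dihedral N) (carrier (dihedral N)) 3 (\<lambda>t. if t \<in> S then (False, 2 mod N) else \<one>\<^bsub>dihedral N\<^esub>)"
proof -
  interpret group "dihedral N" by (rule group_dihedral[OF N])
  let ?G = "dihedral N"
  have bij: "bij_betw (reduce N m) (carrier ?G) (carrier ?G)"
    "bij_betw (\<lambda>t. reduce N m t \<otimes>\<^bsub>?G\<^esub> t) (carrier ?G) (carrier ?G)"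
    unfolding reduce_times_arg using bij_betw_reduce[OF N] m by auto
  show ?thesis
  proof (rule complete_mapping_toggles[OF _ bij _ U(1) _ _ _ _ _ XYW eqs U' c])
    show "inj_on (shift2 N) U"
    proof (rule inj_onI)
      fix x y assume "x \<in> U" "y \<in> U" and eq: "shift2 N x = shift2 N y"
      then have r: "snd x \<in> {0..<N}" "snd y \<in> {0..<N}" using U(1) by (auto simp: carrier_dihedral)
      have "(snd x + 2) mod N = (snd y + 2) mod N" using eq by (simp add: shift2_def)
      then have "snd x mod N = snd y mod N" by (simp add: mod_eq_dvd_iff)
      then show "x = y" using r eq by (simp add: shift2_def prod_eq_iff)
    qed
    show "U \<inter> shift2 N ` U = {}" using U(2,3) by blast
    fix t assume t: "t \<in> U"
    obtain s b where sb: "t = (s, b)" by (cases t)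
    show "reduce N m t \<otimes>\<^bsub>?G\<^esub> shift2 N t = (False, 2 mod N) \<otimes>\<^bsub>?G\<^esub> (reduce N m t \<otimes>\<^bsub>?G\<^esub> t)"
      using U(2)[OF t] by (simp add: sb shift2_def reduce_mult mod_simps) (simp add: ac_simps)
    show "reduce N m (shift2 N t) \<otimes>\<^bsub>?G\<^esub> t =
        (False, 2 mod N) \<otimes>\<^bsub>?G\<^esub> (reduce N m (shift2 N t) \<otimes>\<^bsub>?G\<^esub> shift2 N t)"
      using U(3)[OF t] by (simp add: sb shift2_def reduce_mult mod_simps)
  qed (use N in \<open>auto simp: carrier_dihedral shift2_def\<close>)
qed

text \<open>The pairs join the exponents \<open>4 * j + 1\<close> and \<open>4 * j + 3\<close>;
  there are \<open>2 * h\<close> of them, just enough for \<open>c = 4 * h\<close>.\<close>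

lemma dihedral_factorable_quarter:
  assumes h: "h > 0" and c: "c \<le> nat (4 * h)"
  shows "\<exists>S\<subseteq>carrier (dihedral (4 * h)). card S = c \<and>
    factorable (dihedral (4 * h)) (carrier (dihedral (4 * h))) 3
      (\<lambda>t. if t \<in> S then (False, 2 mod (4 * h)) else \<one>\<^bsub>dihedral (4 * h)\<^esub>)"
proof -
  define U where "U = (\<lambda>(s::bool, j). (s, 4 * j + 1)) ` (UNIV \<times> {0..<h})"
  have card: "card U = 2 * nat h"
    unfolding U_def by (subst card_image) (auto simp: inj_on_def card_cartesian_product)
  have shift: "shift2 (4 * h) (s, 4 * j + 1) = (s, 4 * j + 3)" if "0 \<le> j" "j < h" for s j
    using that by (simp add: shift2_def)
  have in_U: "(False, 1) \<in> U" using h by (auto simp: U_def intro!: image_eqI[of _ _ "(False, 0)"])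
  have map1: "quarter_map h (False, 1) = (False, 2 - 2 * h)"
    "quarter_map h (False, 2) = (True, 2 * h)"
    "quarter_map h (True, h * 4 - 4) = (False, 1 - 2 * h)"
    using quarter_map_simps(2,3)[of h 0] quarter_map_simps(5)[of h "h - 1"]
    by (simp_all add: algebra_simps)
  note map = map1 quarter_map_simps
  \<comment> \<open>Among \<open>X\<close>, \<open>Y\<close>, \<open>W\<close> only \<open>X\<close>
    lies in a pair. Dropping it leaves \<open>2 * h - 1\<close> pairs, which suffices because an odd
    \<open>c\<close> is at most \<open>4 * h - 1\<close>.\<close>
  show ?thesis
  proof (rule dihedral_toggles[where m = "quarter_map h" and U = U and U' = "U - {(False, 1)}"
        and X = "(False, 1)" and Y = "(True, 4 * (h - 1))" and W = "(False, 2)"])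
    show "inj_mod (4 * h) (quarter_map h)" "inj_mod (4 * h) (times_arg (quarter_map h))"
      by (rule inj_mod_quarter_map inj_mod_times_quarter_map)+
    show "U \<subseteq> carrier (dihedral (4 * h))" by (auto simp: U_def carrier_dihedral)
    fix t assume "t \<in> U"
    then obtain s j where t: "t = (s, 4 * j + 1)" "0 \<le> j" "j < h" by (auto simp: U_def)
    show "\<not> fst (quarter_map h t)" by (cases s) (simp_all add: t map)
    show "fst (quarter_map h (shift2 (4 * h) t))" by (cases s) (simp_all add: t shift map)
  next
    show "{(False, 1), (True, 4 * (h - 1)), (False, 2)} \<inter>
        (U - {(False, 1)} \<union> shift2 (4 * h) ` (U - {(False, 1)})) = {}"
      by (auto simp: U_def shift) presburger+
    show "c \<le> 2 * card U" using c h by (simp add: card)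
    have "card (U - {(False, 1)}) = 2 * nat h - 1" using in_U card by simp
    moreover have "c \<le> 4 * nat h" using c h by simp
    moreover have "nat h > 0" using h by simp
    ultimately show "c \<le> 2 * card (U - {(False, 1)}) + 1" if "odd c"
      using that by (elim oddE) simp
  qed (use h in \<open>auto simp: carrier_dihedral map reduce_mult mod_simps algebra_simps mod_eq_dvd_iff\<close>)
qed

text \<open>Three families of \<open>h\<close> pairs can change \<open>6 * h\<close> products, and
  \<open>6 * h \<ge> 4 * h + 2\<close> because \<open>h > 0\<close>. All of them avoid
  \<open>X\<close>, \<open>Y\<close>, \<open>W\<close>, so the same pairs serve both parities of
  \<open>c\<close>.\<close>

lemma dihedral_factorable_odd_half:
  assumes h: "h > 0" and c: "c \<le> nat (4 * h + 2)"
  shows "\<exists>S\<subseteq>carrier (dihedral (4 * h + 2)). card S = c \<and>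
    factorable (dihedral (4 * h + 2)) (carrier (dihedral (4 * h + 2))) 3
      (\<lambda>t. if t \<in> S then (False, 2 mod (4 * h + 2)) else \<one>\<^bsub>dihedral (4 * h + 2)\<^esub>)"
proof -
  define I where "I = {(False, 2), (False, 3), (True, 2 :: int)}"
  define U where "U = (\<lambda>((s::bool, k), j). (s, 4 * j + k)) ` (I \<times> {0..<h})"
  have card: "card U = 3 * nat h"
    unfolding U_def
    by (subst card_image) (auto simp: inj_on_def card_cartesian_product I_def, presburger+)
  have shift: "shift2 (4 * h + 2) (s, 4 * j + 2) = (s, 4 * (j + 1))"
    "shift2 (4 * h + 2) (s, 4 * j + 3) = (s, 4 * (j + 1) + 1)" if "0 \<le> j" "j < h" for s j
    using that by (simp_all add: shift2_def)
  have map1: "odd_half_map h (True, 3) = (True, 2)"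
    using odd_half_map_simps(12)[of 0 h] by simp
  have map4: "fst (odd_half_map h (s, 4 * j + 4))" "fst (odd_half_map h (False, 5 + 4 * j))"
    if "0 \<le> j" for s j
    using that odd_half_map_simps(3,4,9)[of "j + 1" h] by (cases s; simp add: algebra_simps)+
  note map = map1 odd_half_map_simps
  show ?thesis
  proof (rule dihedral_toggles[where m = "odd_half_map h" and U = U and U' = U
        and X = "(False, 1)" and Y = "(True, 3)" and W = "(False, 0)"])
    show "inj_mod (4 * h + 2) (odd_half_map h)" "inj_mod (4 * h + 2) (times_arg (odd_half_map h))"
      using h by (simp_all add: inj_mod_odd_half_map inj_mod_times_odd_half_map)
    show "U \<subseteq> carrier (dihedral (4 * h + 2))" by (auto simp: U_def I_def carrier_dihedral)
    fix t assume "t \<in> U"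
    then obtain s k j where t: "t = (s, 4 * j + k)" "0 \<le> j" "j < h" "(s, k) \<in> I" by (auto simp: U_def)
    show "\<not> fst (odd_half_map h t)" using t by (auto simp: I_def map)
    show "fst (odd_half_map h (shift2 (4 * h + 2) t))" using t by (auto simp: I_def shift map4)
  next
    show "{(False, 1), (True, 3), (False, 0)} \<inter> (U \<union> shift2 (4 * h + 2) ` U) = {}"
      by (auto simp: U_def I_def shift) presburger+
    show "c \<le> 2 * card U" "c \<le> 2 * card U + 1" using c h by (simp_all add: card nat_le_iff) 
  qed (use h in \<open>auto simp: carrier_dihedral map reduce_mult mod_simps algebra_simps mod_eq_dvd_iff\<close>)
qed

lemma (in group) factorable_2_one: "factorable G (carrier G) 2 (\<lambda>_. \<one>)"
proof -
  have "bij_betw (\<lambda>x. inv x) (carrier G) (carrier G)"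
    by (rule bij_betw_byWitness[of _ "\<lambda>x. inv x"]) auto
  then show ?thesis
    unfolding factorable_def
    by (intro exI[of _ "\<lambda>i x. if i = 0 then x else inv x"])
      (auto simp: numeral_2_eq_2 less_Suc_eq bij_betw_def)
qed

lemma even_int_cases:
  fixes N :: int
  assumes "even N" "N > 0"
  obtains "N = 2" | h where "h > 0" "N = 4 * h" | h where "h > 0" "N = 4 * h + 2"
proof -
  have "N = 2 \<or> (\<exists>h. h > 0 \<and> (N = 4 * h \<or> N = 4 * h + 2))"
    using assms by presburger
  then show ?thesis using that by blast
qed

lemma dihedral_complete_mapping:
  fixes N :: int
  assumes "even N" "N > 0"
  obtains p where "bij_betw p (carrier (dihedral N)) (carrier (dihedral N))"
    "bij_betw (\<lambda>t. p t \<otimes>\<^bsub>dihedral N\<^esub> t) (carrier (dihedral N)) (carrier (dihedral N))"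
proof -
  have "\<exists>m. inj_mod N m \<and> inj_mod N (times_arg m)"
    using assms
  proof (cases N rule: even_int_cases)
    case 1
    \<comment> \<open>\<open>N = 2\<close> is \<open>4 * h + 2\<close> for \<open>h = 0\<close>,
      where the map is still complete.\<close>
    then show ?thesis using inj_mod_odd_half_map[of 0] inj_mod_times_odd_half_map[of 0] by auto
  next
    case (2 h)
    then show ?thesis using inj_mod_quarter_map inj_mod_times_quarter_map by blast
  next
    case (3 h)
    then show ?thesis using inj_mod_odd_half_map[of h] inj_mod_times_odd_half_map[of h] by auto
  qed
  then obtain m where "inj_mod N m" "inj_mod N (times_arg m)" by blast
  then show ?thesis
    using that[of "reduce N m"] bij_betw_reduce[OF assms(2)] by (simp add: reduce_times_arg)
qed

lemma card_carrier_dihedral: "card (carrier (dihedral N)) = 2 * nat N"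
  by (simp add: carrier_dihedral card_cartesian_product)

lemma dihedral_factorable_3:
  fixes N :: int
  assumes N: "even N" "N > 0" and c: "c \<le> nat N"
  shows "\<exists>S\<subseteq>carrier (dihedral N). card S = c \<and>
    factorable (dihedral N) (carrier (dihedral N)) 3
      (\<lambda>t. if t \<in> S then (False, 2 mod N) else \<one>\<^bsub>dihedral N\<^esub>)"
  using N
proof (cases N rule: even_int_cases)
  case 1
  interpret group "dihedral N" by (rule group_dihedral[OF N(2)])
  obtain S where S: "S \<subseteq> carrier (dihedral N)" "card S = c"
    using obtain_subset_with_card_n[of c "carrier (dihedral N)"] c by (auto simp: card_carrier_dihedral)
  obtain p where p: "bij_betw p (carrier (dihedral N)) (carrier (dihedral N))"
    "bij_betw (\<lambda>t. p t \<otimes>\<^bsub>dihedral N\<^esub> t) (carrier (dihedral N)) (carrier (dihedral N))"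
    using dihedral_complete_mapping[OF N] .
  \<comment> \<open>For \<open>N = 2\<close> the element \<open>r^2\<close> is the identity, so
    constant products \<open>\<one>\<close> serve for any set of size \<open>c\<close>.\<close>
  have "factorable (dihedral N) (carrier (dihedral N)) 3 (\<lambda>_. \<one>\<^bsub>dihedral N\<^esub>)"
    using factorable_ge[OF p _ factorable_2_one] by simp
  then show ?thesis using S 1 by (intro exI[of _ S]) (auto elim!: factorable_cong)
next
  case (2 h)
  then show ?thesis using dihedral_factorable_quarter[of h c] c unfolding 2(2) by blast
next
  case (3 h)
  then show ?thesis using dihedral_factorable_odd_half[of h c] c unfolding 3(2) by blast
qed

text \<open>Counts above \<open>N\<close> come from the complement, by exchanging the roles of
  \<open>\<one>\<close> and \<open>r^2\<close>. A complete mapping then extends the 3 layers to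
  \<open>g\<close>, and translation by \<open>r^a\<close> yields the two stated values.\<close>

lemma dihedral_factorable:
  fixes N a :: int
  assumes N: "even N" "N > 0" and c: "c \<le> card (carrier (dihedral N))" and g: "g \<ge> 3"
  shows "\<exists>S\<subseteq>carrier (dihedral N). card S = c \<and>
    factorable (dihedral N) (carrier (dihedral N)) g
      (\<lambda>t. if t \<in> S then (False, (a + 2) mod N) else (False, a mod N))"
proof -
  let ?G = "dihedral N"
  let ?C = "carrier ?G"
  let ?z = "(False, 2 mod N)"
  interpret group ?G by (rule group_dihedral[OF N(2)])
  have fin: "finite ?C" by (simp add: carrier_dihedral)
  have zc: "?z \<in> ?C" "(False, a mod N) \<in> ?C" using N(2) by (auto simp: carrier_dihedral)
  have "\<exists>S\<subseteq>?C. card S = c \<and> factorable ?G ?C 3 (\<lambda>t. if t \<in> S then ?z else \<one>\<^bsub>?G\<^esub>)"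
  proof (cases "c \<le> nat N")
    case True
    then show ?thesis by (rule dihedral_factorable_3[OF N])
  next
    case False
    then have "card ?C - c \<le> nat N" by (simp add: card_carrier_dihedral)
    then obtain S where S: "S \<subseteq> ?C" "card S = card ?C - c"
      and F: "factorable ?G ?C 3 (\<lambda>t. if t \<in> S then ?z else \<one>\<^bsub>?G\<^esub>)"
      using dihedral_factorable_3[OF N] by blast
    have "factorable ?G ?C 3
        (\<lambda>t. (case if t \<in> S then ?z else \<one>\<^bsub>?G\<^esub> of (s, x) \<Rightarrow> (s, (- x) mod N)) \<otimes>\<^bsub>?G\<^esub> ?z)"
      using factorable_mult_right[OF _ factorable_iso[OF F dihedral_neg_iso[OF N(2)]] zc(1)] by simp
    then have "factorable ?G ?C 3 (\<lambda>t. if t \<in> ?C - S then ?z else \<one>\<^bsub>?G\<^esub>)"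
      by (rule factorable_cong) (auto simp: mod_simps)
    moreover have "card (?C - S) = c"
      using S c fin by (simp add: card_Diff_subset finite_subset)
    ultimately show ?thesis by (intro exI[of _ "?C - S"]) auto
  qed
  then obtain S where S: "S \<subseteq> ?C" "card S = c"
    and F: "factorable ?G ?C 3 (\<lambda>t. if t \<in> S then ?z else \<one>\<^bsub>?G\<^esub>)" by blast
  obtain p where p: "bij_betw p ?C ?C" "bij_betw (\<lambda>t. p t \<otimes>\<^bsub>?G\<^esub> t) ?C ?C"
    using dihedral_complete_mapping[OF N] .
  have "factorable ?G ?C g (\<lambda>t. if t \<in> S then ?z else \<one>\<^bsub>?G\<^esub>)"
    by (rule factorable_ge[OF p _ F g]) simp
  then have "factorable ?G ?C g (\<lambda>t. (if t \<in> S then ?z else \<one>\<^bsub>?G\<^esub>) \<otimes>\<^bsub>?G\<^esub> (False, a mod N))"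
    using zc(2) g by (intro factorable_mult_right) auto
  then have "factorable ?G ?C g (\<lambda>t. if t \<in> S then (False, (a + 2) mod N) else (False, a mod N))"
    by (rule factorable_cong) (auto simp: mod_simps add.commute)
  then show ?thesis using S by blast
qed

section \<open>Distributing the two orders\<close>

text \<open>Fill the elements of \<open>A\<close> greedily, each up to the capacity
  \<open>w\<close>.\<close>

lemma exists_bounded_sum:
  fixes w :: nat
  assumes "finite A" "\<alpha> \<le> w * card A"
  shows "\<exists>c. (\<forall>s\<in>A. c s \<le> w) \<and> sum c A = \<alpha>"
  using assms
proof (induction A arbitrary: \<alpha> rule: finite_induct)
  case empty
  then show ?case by simp
next
  case (insert x A)
  have "\<alpha> - min w \<alpha> \<le> w * card A" using insert by auto
  then obtain c where c: "\<forall>s\<in>A. c s \<le> w" "sum c A = \<alpha> - min w \<alpha>" using insert.IH by blast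
  have "sum (c(x := min w \<alpha>)) A = sum c A"
    using insert.hyps by (intro sum.cong) auto
  then show ?case using c insert.hyps
    by (intro exI[of _ "c(x := min w \<alpha>)"]) auto
qed

text \<open>Each prime power goes to \<open>U\<close> or \<open>V\<close> according to which of
  \<open>a\<close> and \<open>b\<close> has the larger exponent, ties going to \<open>V\<close>. The
  smaller exponents are supplied by \<open>gcd a b\<close>.\<close>

lemma lcm_coprime_split:
  fixes a b :: nat
  assumes "a > 0" "b > 0"
  obtains U V where "coprime U V" "U * V = lcm a b" "lcm U (gcd a b) = a" "lcm V (gcd a b) = b"
proof -
  define P where "P = {p \<in> prime_factors a. multiplicity p b < multiplicity p a}"
  define Q where "Q = {p \<in> prime_factors b. multiplicity p a \<le> multiplicity p b}"
  define U where "U = (\<Prod>p\<in>P. p ^ multiplicity p a)"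
  define V where "V = (\<Prod>p\<in>Q. p ^ multiplicity p b)"
  have P: "finite P" "\<And>p. p \<in> P \<Longrightarrow> prime p" and Q: "finite Q" "\<And>p. p \<in> Q \<Longrightarrow> prime p"
    by (auto simp: P_def Q_def)
  have U0: "U > 0" and V0: "V > 0"
    unfolding U_def V_def by (intro prod_pos; simp add: P(2) Q(2) prime_gt_0_nat)+
  have pf: "p \<in> prime_factors x \<longleftrightarrow> multiplicity p x > 0" if "prime p" "x > 0" for p x :: nat
    using that by (simp add: prime_factors_multiplicity)
  have mU: "multiplicity p U = (if multiplicity p b < multiplicity p a then multiplicity p a else 0)"
    if "prime p" for p
    unfolding U_def using multiplicity_prod_prime_powers[OF P that] pf[OF that] assms that
    by (auto simp: P_def)
  have mV: "multiplicity p V = (if multiplicity p a \<le> multiplicity p b then multiplicity p b else 0)"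
    if "prime p" for p
    unfolding V_def using multiplicity_prod_prime_powers[OF Q that] pf[OF that] assms that
    by (auto simp: Q_def)
  have g0: "gcd a b > 0" "lcm a b > 0" using assms by (auto simp: lcm_pos_nat)
  show ?thesis
  proof
    show "coprime U V"
    proof (rule ccontr)
      assume "\<not> coprime U V"
      then obtain p where p: "prime p" "p dvd U" "p dvd V"
        by (metis coprime_iff_gcd_eq_1 gcd_dvd1 gcd_dvd2 dvd_trans prime_factor_nat)
      then have "multiplicity p U > 0" "multiplicity p V > 0"
        using U0 V0 prime_multiplicity_gt_zero_iff[of p] by auto
      then show False using mU[OF p(1)] mV[OF p(1)] by (auto split: if_splits)
    qed
    have mg: "multiplicity p (gcd a b) = min (multiplicity p a) (multiplicity p b)" if "prime p" for p
      using that assms by (intro multiplicity_gcd) auto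
    have mult: "multiplicity p (U * V) = multiplicity p U + multiplicity p V" if "prime p" for p
      using that U0 V0 by (intro prime_elem_multiplicity_mult_distrib) auto
    have ml: "multiplicity p (lcm x y) = max (multiplicity p x) (multiplicity p y)"
      if "x > 0" "y > 0" "prime p" for p x y :: nat
      using that by (intro multiplicity_lcm) auto
    show "U * V = lcm a b"
      by (rule multiplicity_eq_nat) (use U0 V0 g0 ml[OF assms] mult mU mV in auto)
    show "lcm U (gcd a b) = a"
      by (rule multiplicity_eq_nat)
        (use U0 g0(1) assms ml[OF U0 g0(1)] mg mU in \<open>auto simp: lcm_pos_nat\<close>)
    show "lcm V (gcd a b) = b"
      by (rule multiplicity_eq_nat)
        (use V0 g0(1) assms ml[OF V0 g0(1)] mg mV in \<open>auto simp: lcm_pos_nat\<close>)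
  qed
qed

text \<open>By Bezout there is \<open>x = t * V\<close> congruent to 1 modulo \<open>U\<close> and
  to 0 modulo \<open>V\<close>. Hence \<open>x\<close> has additive order \<open>U\<close> modulo
  \<open>U * V\<close>, and \<open>x - 1\<close> has order \<open>V\<close>.\<close>

lemma coprime_idempotent:
  fixes U V :: int
  assumes "coprime U V" "U > 0" "V > 0"
  obtains x where "\<And>r. U * V dvd x * r \<longleftrightarrow> U dvd r" "\<And>r. U * V dvd (x - 1) * r \<longleftrightarrow> V dvd r"
proof -
  obtain s t where st: "s * U + t * V = 1"
    using assms(1) bezout_int[of U V] by (auto simp: coprime_iff_gcd_eq_1)
  have "coprime U t"
    by (rule coprimeI) (metis st dvd_add dvd_mult dvd_mult2)
  moreover have "coprime V s"
    by (rule coprimeI) (metis st dvd_add dvd_mult dvd_mult2)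
  ultimately have c: "coprime U t" "coprime V s" .
  have "U * V dvd (t * V) * r \<longleftrightarrow> U dvd r" for r
  proof -
    have "U * V dvd (t * V) * r \<longleftrightarrow> V * U dvd V * (t * r)" by (simp add: ac_simps)
    then show ?thesis using assms c(1) by (simp add: coprime_dvd_mult_right_iff)
  qed
  moreover have "U * V dvd (t * V - 1) * r \<longleftrightarrow> V dvd r" for r
  proof -
    have "t * V - 1 = - (U * s)" using st by (simp add: algebra_simps)
    then have "U * V dvd (t * V - 1) * r \<longleftrightarrow> U * V dvd U * (s * r)" by (simp add: ac_simps)
    then show ?thesis using assms c(2) by (simp add: coprime_dvd_mult_right_iff)
  qed
  ultimately show ?thesis using that by blast
qed

lemma pow_DirProd:
  "(a, b) [^]\<^bsub>G \<times>\<times> H\<^esub> (r::nat) = (a [^]\<^bsub>G\<^esub> r, b [^]\<^bsub>H\<^esub> r)"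
  by (induction r) (simp_all add: nat_pow_def)

text \<open>The rotations with exponents \<open>2 * x\<close> and \<open>2 * (x - 1)\<close> differ by the square of the generator and
  have orders \<open>U\<close> and \<open>V\<close>; the constant component of order \<open>q = gcd m b\<close> raises these orders to \<open>m\<close>
  and \<open>b\<close>. The number of products of the first kind is chosen separately for every element of the
  cyclic factor.\<close>

lemma HWP_Cg_blowup_four_mult:
  assumes g: "g \<ge> 3" and m: "odd m" and b: "b > 0" and sum: "\<alpha> + \<beta> = 4 * m * b"
  shows "HWP (Cg_blowup g (4 * m * b)) (g * m) (g * b) \<alpha> \<beta>"
proof -
  have m0: "m > 0" using m by (rule odd_pos)
  define q where "q = gcd m b"
  obtain U V where UV: "coprime U V" "U * V = lcm m b" "lcm U q = m" "lcm V q = b"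
    unfolding q_def using lcm_coprime_split[OF m0 b] .
  have pos: "U > 0" "V > 0" using UV(2) m0 b by (metis lcm_pos_nat mult_is_0 neq0_conv)+
  \<comment> \<open>The cyclic factor needs odd order for its complete mapping; this is where
    \<open>m\<close> being odd enters.\<close>
  have "odd q" using m q_def by (metis dvd_trans gcd_dvd1)
  then have q0: "q > 0" by (rule odd_pos)
  define N where "N = 2 * (int U * int V)"
  have N: "even N" "N > 0" using pos by (auto simp: N_def)
  let ?D = "dihedral N"
  let ?Z = "integer_mod_group q"
  let ?G = "?D \<times>\<times> ?Z"
  let ?C = "carrier ?D"
  let ?Y = "carrier ?Z"
  interpret D: group ?D by (rule group_dihedral[OF N(2)])
  interpret Z: group ?Z by simp
  interpret G: group ?G by (rule DirProd_group[OF D.is_group Z.is_group])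
  have Y: "?Y = {0..<int q}" using q0 by (simp add: carrier_integer_mod_group)
  have fin: "finite ?C" "finite ?Y" by (auto simp: carrier_dihedral Y)
  have "nat N = 2 * (U * V)" by (simp add: N_def nat_mult_distrib)
  then have cC: "card ?C * q = 4 * m * b"
    using UV(2) prod_gcd_lcm_nat[of m b] by (simp add: card_carrier_dihedral q_def ac_simps)
  obtain x where x: "\<And>r. int U * int V dvd x * r \<longleftrightarrow> int U dvd r"
    "\<And>r. int U * int V dvd (x - 1) * r \<longleftrightarrow> int V dvd r"
    using coprime_idempotent[of "int U" "int V"] UV(1) pos by auto
  obtain c where c: "\<And>y. y \<in> ?Y \<Longrightarrow> c y \<le> card ?C" "sum c ?Y = \<alpha>"
  proof -
    have "\<alpha> \<le> card ?C * card ?Y" using sum cC by (simp add: Y)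
    then show ?thesis using that exists_bounded_sum[OF fin(2)] by blast
  qed
  define a where "a = 2 * (x - 1)"
  have "\<exists>S. S \<subseteq> ?C \<and> card S = c y \<and>
      factorable ?D ?C g (\<lambda>t. if t \<in> S then (False, (a + 2) mod N) else (False, a mod N))"
    if "y \<in> ?Y" for y
    using dihedral_factorable[OF N c(1)[OF that] g, of a] by blast
  then obtain S where S: "\<And>y. y \<in> ?Y \<Longrightarrow> S y \<subseteq> ?C" "\<And>y. y \<in> ?Y \<Longrightarrow> card (S y) = c y"
    and F: "\<And>y. y \<in> ?Y \<Longrightarrow> factorable ?D ?C g
        (\<lambda>t. if t \<in> S y then (False, (a + 2) mod N) else (False, a mod N))"
    by metis
  let ?d = "\<lambda>(t, y). (if t \<in> S y then (False, (a + 2) mod N) else (False, a mod N), 1 mod int q)"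
  have fact: "factorable ?G (?C \<times> ?Y) g ?d"
    using factorable_DirProd[OF D.is_group Z.is_group F factorable_integer_mod_group[OF \<open>odd q\<close>]] g
    by simp
  define R where "R = {(t, y). y \<in> ?Y \<and> t \<in> S y}"
  have R_sub: "R \<subseteq> ?C \<times> ?Y" using S(1) by (auto simp: R_def)
  have "R = prod.swap ` (SIGMA y:?Y. S y)" by (auto simp: R_def image_iff)
  then have "card R = card (SIGMA y:?Y. S y)" by (simp add: card_image)
  also have "\<dots> = (\<Sum>y\<in>?Y. card (S y))"
    using fin S(1) by (intro card_SigmaI) (auto intro: finite_subset)
  finally have "card R = (\<Sum>y\<in>?Y. card (S y))" .
  then have cR: "card R = \<alpha>" using S(2) c(2) by simp
  have "card (?C \<times> ?Y) = 4 * m * b" using cC by (simp add: card_cartesian_product Y)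
  then have cR': "card (?C \<times> ?Y - R) = \<beta>"
    using R_sub cR fin sum by (simp add: card_Diff_subset finite_subset)
  have pow: "((False, e mod N), 1 mod int q) [^]\<^bsub>?G\<^esub> r = \<one>\<^bsub>?G\<^esub> \<longleftrightarrow> N dvd int r * e \<and> q dvd r"
    for e and r :: nat
    using N(2) by (simp add: pow_DirProd pow_dihedral mod_simps dvd_eq_mod_eq_0 flip: of_nat_mod)
  show ?thesis
  proof (rule G.HWP_of_factorable[OF _ _ g fact R_sub cR cR'])
    show "finite (carrier ?G)" using fin by simp
    show "card (carrier ?G) = 4 * m * b" using cC by (simp add: card_cartesian_product Y)
    fix t and r :: nat
    \<comment> \<open>Since \<open>a + 2 = 2 * x\<close>, the factor 2 cancels against the one in
      \<open>N\<close>.\<close>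
    have "N dvd int r * (a + 2) \<longleftrightarrow> int U * int V dvd x * int r"
      using dvd_mult_cancel_left[of 2 "int U * int V" "x * int r"] by (simp add: N_def a_def algebra_simps)
    then have 1: "N dvd int r * (a + 2) \<and> q dvd r \<longleftrightarrow> m dvd r"
      using x(1)[of "int r"] UV(3) by (auto simp: lcm_least_iff[symmetric])
    have "N dvd int r * a \<longleftrightarrow> int U * int V dvd (x - 1) * int r"
      using dvd_mult_cancel_left[of 2 "int U * int V" "(x - 1) * int r"] by (simp add: N_def a_def algebra_simps)
    then have 2: "N dvd int r * a \<and> q dvd r \<longleftrightarrow> b dvd r"
      using x(2)[of "int r"] UV(4) by (auto simp: lcm_least_iff[symmetric])
    show "?d t [^]\<^bsub>?G\<^esub> r = \<one>\<^bsub>?G\<^esub> \<longleftrightarrow> m dvd r" if "t \<in> R"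
      using that 1 by (auto simp: R_def pow simp del: one_DirProd)
    show "?d t [^]\<^bsub>?G\<^esub> r = \<one>\<^bsub>?G\<^esub> \<longleftrightarrow> b dvd r" if "t \<in> ?C \<times> ?Y - R"
      using that 2 by (auto simp: R_def pow simp del: one_DirProd)
  qed (use m0 b in auto)
qed

theorem mainTheorem16:
  fixes g k m n \<alpha> \<beta> :: nat
  assumes "g \<ge> 3" and "odd m" and "odd n"
  shows "HWP (Cg_blowup g (2 ^ (k + 2) * m * n)) (g * m) (2 ^ k * g * n) \<alpha> \<beta>
         \<longleftrightarrow> \<alpha> + \<beta> = 2 ^ (k + 2) * m * n"
proof
  have "m > 0" "n > 0" using assms(2,3) by (auto intro: odd_pos)
  then show "\<alpha> + \<beta> = 2 ^ (k + 2) * m * n"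
    if "HWP (Cg_blowup g (2 ^ (k + 2) * m * n)) (g * m) (2 ^ k * g * n) \<alpha> \<beta>"
    using HWP_Cg_blowup_imp_sum[OF assms(1) _ that] by simp
  \<comment> \<open>Sufficiency is the case \<open>b = 2 ^ k * n\<close> of the
    construction.\<close>
  have eq: "4 * m * (2 ^ k * n) = 2 ^ (k + 2) * m * n" "g * (2 ^ k * n) = 2 ^ k * g * n"
    by (simp_all add: power_add)
  assume "\<alpha> + \<beta> = 2 ^ (k + 2) * m * n"
  then show "HWP (Cg_blowup g (2 ^ (k + 2) * m * n)) (g * m) (2 ^ k * g * n) \<alpha> \<beta>"
    using HWP_Cg_blowup_four_mult[OF assms(1,2), of "2 ^ k * n" \<alpha> \<beta>] \<open>n > 0\<close>
    unfolding eq by simp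
qed

end
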